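(* Let $s,t\ge1$ be coprime integers, let $t'=\lfloor t/2\rfloor$, and let $\lambda$ be a self-conjugate $s$-core with $t$-core $\lambda^t$. Write $z_{t,i}=z_{t,i}(\lambda^t)$ and $u_i=u_i(\lambda^t)$. (1) If $t$ is odd, then $$|\mathrm{Stab}_{H_{s,t}}(\lambda)|=2^{\lfloor z_{t,0}/2\rfloor}\,\lfloor z_{t,0}/2\rfloor!\,\prod_{i=1}^{t'}z_{t,i}!=2^{u_0}\prod_{i=0}^{t'}u_i!.$$ (2) If $t$ is even (so $s$ is odd), then $$|\mathrm{Stab}_{H_{s,t}}(\lambda)|=2^{\lfloor z_{t,0}/2\rfloor}\,\lfloor z_{t,0}/2\rfloor!\;2^{\lfloor z_{t,t'}/2\rfloor}\,\lfloor z_{t,t'}/2\rfloor!\,\prod_{i=1}^{t'-1}z_{t,i}!=2^{u_0+u_{t'}}\prod_{i=0}^{t'}u_i!.$$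
   Context: A partition is an infinite weakly decreasing sequence $\lambda=(\lambda_1,\lambda_2,\ldots)$ of nonnegative integers with finite sum. Its Young diagram is $[\lambda]=\{(r,c)\in\mathbb{Z}_{>0}^2 : c\le\lambda_r\}$, its conjugate $\overline{\lambda}$ is given by $\overline{\lambda}_r=\#\{c\in\mathbb{Z}_{>0}: r\le\lambda_c\}$; $\lambda$ is self-conjugate if $\lambda=\overline\lambda$. The rim hook of $(r,c)\in[\lambda]$ is $\{(i,j)\in[\lambda]: i\ge r,\ j\ge c,\ (i+1,j+1)\notin[\lambda]\}$, of length $1+(\lambda_r-r)+(\overline{\lambda}_c-c)$; removing it leaves the Young diagram of a smaller partition. A partition is an $s$-core if it has no rim hook of length $s$; $\mathcal{C}_s$ (resp. $\mathcal{D}_s$) is the set of $s$-cores (resp. self-conjugate $s$-cores). For any partition $\lambda$ and $t\ge1$, repeatedly removing rim hooks of length $t$ until none remains yields a $t$-core, independent of the choices made, denoted $\lambda^t$; if $\lambda\in\mathcal{D}_s$ then $\lambda^t\in\mathcal{D}_s\cap\mathcal{D}_t$. The beta-set of $\lambda$ is $B^\lambda=\{\lambda_i-i: i\ge1\}\subset\mathbb{Z}$. For an $s$-core $\lambda$ the $s$-set is $\mathcal{S}_s(\lambda)=(B^\lambda+s)\setminus B^\lambda$; $\lambda\mapsto\mathcal{S}_s(\lambda)$ is a bijection from $\mathcal{C}_s$ to the collection of all sets of $s$ integers pairwise incongruent modulo $s$ with sum $\binom s2$, and an $s$-core $\lambda$ is self-conjugate iff $\mathcal{S}_s(\lambda)=s-1-\mathcal{S}_s(\lambda)$.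 Coordinates of a $t$-core $\mu$: $a_{t,i}(\mu)=t+\max[B^\mu\cap(i+t\mathbb{Z})]$ for $i\in\mathbb{Z}/t\mathbb{Z}$; with $k=\frac12(s+1)(t-1)\in\mathbb{Z}$, $z_{t,j}(\mu)=\frac1t\bigl(a_{t,sj+k}(\mu)-[a_{t,s(j+1)+k}(\mu)-s]\bigr)$ for $j\in\mathbb{Z}/t\mathbb{Z}$. For $\mu\in\mathcal{D}_s\cap\mathcal{D}_t$ the $z_{t,j}(\mu)$ are nonnegative integers with $z_{t,j}=z_{t,-j}$ (and $z_{t,t'}$ even if $t$ is even), and the $u$-coordinates are $u_0=\lfloor z_{t,0}/2\rfloor$ together with $u_i=z_{t,i}$ for $1\le i\le t'$ if $t$ is odd; and $u_i=z_{t,i}$ for $1\le i\le t'-1$, $u_{t'}=z_{t,t'}/2$ if $t$ is even. $H_{s,t}$ is the group (under composition) of permutations $f:\mathbb{Z}\to\mathbb{Z}$ such that $f(m+s)=f(m)+s$ for all $m$; $\sum_{i=0}^{s-1}f(i)=\binom{s}{2}$; $f(m)\equiv m\pmod t$ for all $m$; and $f(-1-m)=-1-f(m)$ for all $m$. It acts on $\mathcal{D}_s$ by letting $f\lambda$ be the self-conjugate $s$-core with $\mathcal{S}_s(f\lambda)=f(\mathcal{S}_s(\lambda))$. *)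

theory Defs
  imports "HOL-Algebra.Group_Action" "HOL-Number_Theory.Cong"
begin

section \<open>Partitions, rim hooks and cores\<close>

text \<open>
  Rows and columns are numbered from 0: the part \<open>\<lambda>\<^sub>r\<close> of the usual 1-based notation is
  \<open>lam (r - 1)\<close>, and the box \<open>(r, c)\<close> is \<open>(r - 1, c - 1)\<close>.
\<close>

definition is_partition :: "(nat \<Rightarrow> nat) \<Rightarrow> bool" where
  "is_partition lam \<longleftrightarrow> antimono lam \<and> finite {i. lam i \<noteq> 0}"

definition young_diagram :: "(nat \<Rightarrow> nat) \<Rightarrow> (nat \<times> nat) set" where
  "young_diagram lam = {(r, c). c < lam r}"

definition conjugate :: "(nat \<Rightarrow> nat) \<Rightarrow> nat \<Rightarrow> nat" where
  "conjugate lam r = card {c. r < lam c}"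

definition rim_hook :: "(nat \<Rightarrow> nat) \<Rightarrow> nat \<times> nat \<Rightarrow> (nat \<times> nat) set" where
  "rim_hook lam = (\<lambda>(r, c).
     {(i, j) \<in> young_diagram lam. r \<le> i \<and> c \<le> j \<and> (i + 1, j + 1) \<notin> young_diagram lam})"

definition remove_rim_hook :: "nat \<Rightarrow> (nat \<Rightarrow> nat) \<Rightarrow> (nat \<Rightarrow> nat) \<Rightarrow> bool" where
  "remove_rim_hook t lam mu \<longleftrightarrow> is_partition lam \<and> is_partition mu \<and>
     (\<exists>x \<in> young_diagram lam. card (rim_hook lam x) = t \<and>
        young_diagram mu = young_diagram lam - rim_hook lam x)"

definition cores :: "nat \<Rightarrow> (nat \<Rightarrow> nat) set" where
  "cores s = {lam. is_partition lam \<and> (\<forall>x \<in> young_diagram lam. card (rim_hook lam x) \<noteq> s)}"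

definition self_conjugate_cores :: "nat \<Rightarrow> (nat \<Rightarrow> nat) set" where
  "self_conjugate_cores s = {lam \<in> cores s. conjugate lam = lam}"

definition core_of :: "nat \<Rightarrow> (nat \<Rightarrow> nat) \<Rightarrow> (nat \<Rightarrow> nat)" where
  "core_of t lam = (THE mu. (remove_rim_hook t)\<^sup>*\<^sup>* lam mu \<and> mu \<in> cores t)"


section \<open>Beta-sets, s-sets and coordinates\<close>

text \<open>The shift by 1 turns \<open>\<lambda>\<^sub>i - i\<close> for \<open>i \<ge> 1\<close> into a formula in the 0-based index.\<close>

definition beta_set :: "(nat \<Rightarrow> nat) \<Rightarrow> int set" where
  "beta_set lam = {int (lam i) - (int i + 1) |i. True}"

definition s_set :: "nat \<Rightarrow> (nat \<Rightarrow> nat) \<Rightarrow> int set" where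
  "s_set s lam = (\<lambda>b. b + int s) ` beta_set lam - beta_set lam"

text \<open>
  Indices in \<open>\<int>/t\<int>\<close> are represented by arbitrary integers. The set whose maximum is taken is
  infinite but bounded above, so \<open>GREATEST\<close> is used rather than \<open>Max\<close>.
\<close>

definition a_coord :: "nat \<Rightarrow> (nat \<Rightarrow> nat) \<Rightarrow> int \<Rightarrow> int" where
  "a_coord t mu i = int t + (GREATEST b. b \<in> beta_set mu \<and> [b = i] (mod int t))"

definition k_shift :: "nat \<Rightarrow> nat \<Rightarrow> int" where
  "k_shift s t = (int s + 1) * (int t - 1) div 2"

text \<open>The division is exact; see \<open>z_coord_exact\<close> below.\<close>

definition z_coord :: "nat \<Rightarrow> nat \<Rightarrow> (nat \<Rightarrow> nat) \<Rightarrow> int \<Rightarrow> int" where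
  "z_coord s t mu j =
     (a_coord t mu (int s * j + k_shift s t)
        - (a_coord t mu (int s * (j + 1) + k_shift s t) - int s)) div int t"

text \<open>
  The \<open>u\<close>-coordinates, meaningful for \<open>0 \<le> i \<le> t div 2\<close> and \<open>mu\<close> a self-conjugate
  \<open>s\<close>-core and \<open>t\<close>-core. In that case all \<open>z\<close>-coordinates are nonnegative, so \<open>nat\<close> does not
  truncate, and for even \<open>t\<close> the one at index \<open>t div 2\<close> is even.
\<close>

definition u_coord :: "nat \<Rightarrow> nat \<Rightarrow> (nat \<Rightarrow> nat) \<Rightarrow> nat \<Rightarrow> nat" where
  "u_coord s t mu i =
     (if i = 0 then nat (z_coord s t mu 0 div 2)
      else if even t \<and> i = t div 2 then nat (z_coord s t mu (int i) div 2)
      else nat (z_coord s t mu (int i)))"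


section \<open>The group and its action\<close>

definition H_group :: "nat \<Rightarrow> nat \<Rightarrow> (int \<Rightarrow> int) monoid" where
  "H_group s t =
     \<lparr>carrier = {f. bij f
        \<and> (\<forall>m. f (m + int s) = f m + int s)
        \<and> (\<Sum>i\<in>{0..<int s}. f i) = int (s choose 2)
        \<and> (\<forall>m. [f m = m] (mod int t))
        \<and> (\<forall>m. f (- 1 - m) = - 1 - f m)},
      monoid.mult = (\<circ>), one = id\<rparr>"

definition H_action :: "nat \<Rightarrow> (int \<Rightarrow> int) \<Rightarrow> (nat \<Rightarrow> nat) \<Rightarrow> (nat \<Rightarrow> nat)" where
  "H_action s f lam = (THE mu. mu \<in> self_conjugate_cores s \<and> s_set s mu = f ` s_set s lam)"


section \<open>Exactness of the division in the z-coordinates\<close>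

lemma a_coord_cong:
  assumes "is_partition mu" and "t \<ge> 1"
  shows "[a_coord t mu i = i] (mod int t)"
proof -
  define P where "P = (\<lambda>b. b \<in> beta_set mu \<and> [b = i] (mod int t))"
  have "finite {i. mu i \<noteq> 0}" using assms(1) by (simp add: is_partition_def)
  then obtain N where N: "\<And>n. n \<ge> N \<Longrightarrow> mu n = 0"
    by (metis (mono_tags, lifting) finite_nat_set_iff_bounded linorder_not_le mem_Collect_eq)
  define b0 where "b0 = (i mod int t) - int t * (int N + 1)"
  have "b0 \<le> - int N - 1"
  proof -
    have "i mod int t < int t" using assms(2) by simp
    moreover have "int t * (int N + 1) = int t * int N + int t" by (simp add: algebra_simps)
    moreover have "int N \<le> int t * int N" using assms(2) by (simp add: mult_le_cancel_right1)
    ultimately show ?thesis by (simp add: b0_def)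
  qed
  then have "mu (nat (- b0 - 1)) = 0" "int (nat (- b0 - 1)) = - b0 - 1" using N by auto
  then have "b0 \<in> beta_set mu"
    unfolding beta_set_def by (auto intro!: exI[of _ "nat (- b0 - 1)"])
  moreover have "[b0 = i] (mod int t)"
    by (simp add: b0_def cong_def mod_diff_eq)
       (metis minus_mult_right mod_mod_trivial mod_mult_self2 uminus_add_conv_diff add.commute)
  ultimately have P0: "P b0" by (simp add: P_def)
  have bound: "b \<le> int (mu 0)" if Pb: "P b" for b
  proof -
    obtain n where n: "b = int (mu n) - (int n + 1)" using Pb by (auto simp: P_def beta_set_def)
    have "mu n \<le> mu 0" using assms(1) by (auto simp: is_partition_def dest: antimonoD)
    then show ?thesis using n by simp
  qed
  define S where "S = {b. P b \<and> b0 \<le> b}"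
  have finS: "finite S" by (rule finite_subset[of _ "{b0..int (mu 0)}"]) (auto simp: S_def bound)
  have "b0 \<in> S" using P0 by (simp add: S_def)
  then have MS: "Max S \<in> S" using finS by (auto intro: Max_in)
  have "P (Greatest P)"
  proof (rule GreatestI2_order)
    show "P (Max S)" using MS by (simp add: S_def)
    show "y \<le> Max S" if "P y" for y
    proof (cases "b0 \<le> y")
      case True
      then show ?thesis using that finS by (auto simp: S_def)
    next
      case False
      then show ?thesis using MS by (auto simp: S_def)
    qed
  qed
  then show ?thesis
    by (simp add: a_coord_def P_def cong_def)
qed

lemma z_coord_exact:
  assumes "is_partition mu" and "t \<ge> 1"
  shows "int t * z_coord s t mu j =
     a_coord t mu (int s * j + k_shift s t)
       - (a_coord t mu (int s * (j + 1) + k_shift s t) - int s)"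
proof -
  have "[a_coord t mu (int s * j + k_shift s t) - (a_coord t mu (int s * (j + 1) + k_shift s t) - int s)
     = (int s * j + k_shift s t) - ((int s * (j + 1) + k_shift s t) - int s)] (mod int t)"
    by (intro cong_diff cong_refl a_coord_cong assms)
  then have "int t dvd a_coord t mu (int s * j + k_shift s t)
      - (a_coord t mu (int s * (j + 1) + k_shift s t) - int s)"
    by (simp add: algebra_simps cong_0_iff)
  then show ?thesis by (simp add: z_coord_def)
qed

end

theory Submission
  imports Defs "HOL-Library.Infinite_Set" "HOL-Combinatorics.Permutations"
begin

text \<open>
  Write \<open>S\<close> for the \<open>s\<close>-set of \<open>\<lambda>\<close>. Since \<open>S\<close> represents every residue class modulo \<open>s\<close> once, an
  element of the stabilizer is the same thing as a permutation of \<open>S\<close> that preserves residues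
  modulo \<open>t\<close> and commutes with the involution \<open>x \<mapsto> s - 1 - x\<close>. Removing a rim hook of length \<open>t\<close>
  moves one bead down by \<open>t\<close>, so bead counts in residue classes modulo \<open>t\<close> are unchanged, and
  comparing the counts for \<open>B\<close> and \<open>B + s\<close> shows that \<open>S\<close> has exactly \<open>z\<^sub>j\<close> elements congruent to
  \<open>s (j + 1) + k\<close>. The involution swaps the classes \<open>j\<close> and \<open>- j\<close>. A pair of distinct classes
  contributes \<open>z\<^sub>j!\<close>, and a class fixed by the involution contributes the order of a
  hyperoctahedral group of rank \<open>z\<^sub>j div 2\<close>.
\<close>

section \<open>Beads and gaps\<close>

text \<open>Both \<open>core_of\<close> and \<open>H_action\<close> are definite descriptions, so
  the proof has to show that removing rim hooks ends in a unique core and that a group element sends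
  a beta-set to a beta-set. Hence the dictionary between partitions and sets of integers is built in
  both directions. Its main tool is the number of beads at or above a given content: it recovers the
  Young diagram, and it identifies removal of a rim hook with moving one bead into a smaller gap.

  The involution negates class indices because \<open>2 * k_shift s t\<close> is congruent to
  \<open>- (s + 1)\<close> modulo \<open>t\<close>, which cancels exactly the offset left by
  \<open>x \<mapsto> s - 1 - x\<close>. Negation modulo \<open>t\<close> fixes the index 0, and also
  \<open>t div 2\<close> when \<open>t\<close> is even. The rounding in \<open>z div 2\<close> comes
  from the centre \<open>(s - 1) / 2\<close>, the only possible fixed point of the involution: the
  other points of a self-paired class form pairs, and permuting \<open>m\<close> pairs with
  independent swaps inside them gives \<open>2 ^ m * fact m\<close>.\<close>

definition bead :: "(nat \<Rightarrow> nat) \<Rightarrow> nat \<Rightarrow> int" where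
  "bead lam i = int (lam i) - (int i + 1)"

text \<open>Beads label rows, and these numbers label columns: they turn out to be exactly the
  integers outside the beta-set. The hook at \<open>(r, c)\<close> then has length
  \<open>bead lam r - gap lam c\<close>.\<close>

definition gap :: "(nat \<Rightarrow> nat) \<Rightarrow> nat \<Rightarrow> int" where
  "gap lam c = int c - int (conjugate lam c)"

text \<open>The argument \<open>d\<close> plays the role of a content \<open>j - i\<close>: on that
  diagonal the boxes of the diagram are those whose row index is below this count.\<close>

definition beads_from :: "int set \<Rightarrow> int \<Rightarrow> nat" where
  "beads_from B d = card {b \<in> B. d \<le> b}"

lemma beta_set_eq: "beta_set lam = range (bead lam)"
  by (auto simp: beta_set_def bead_def)

text \<open>Turns a cardinality into a threshold; \<open>beads_from\<close> and
  \<open>conjugate\<close> are used only through such strict inequalities.\<close>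

lemma finite_downset_iff:
  fixes I :: "nat set"
  assumes "finite I" and "\<And>i j. j \<in> I \<Longrightarrow> i \<le> j \<Longrightarrow> i \<in> I"
  shows "i < card I \<longleftrightarrow> i \<in> I"
proof -
  define n where "n = (LEAST n. n \<notin> I)"
  have n: "n \<notin> I"
    unfolding n_def by (rule LeastI_ex) (use assms(1) ex_new_if_finite infinite_UNIV_nat in blast)
  moreover have "m \<in> I" if "m < n" for m
    using not_less_Least[of m "\<lambda>n. n \<notin> I"] that by (auto simp: n_def)
  ultimately have "I = {..<n}" using assms(2) by (auto simp flip: not_le)
  then show ?thesis by simp
qed

lemma partition_antimono: "is_partition lam \<Longrightarrow> i \<le> j \<Longrightarrow> lam j \<le> lam i"
  unfolding is_partition_def by (blast dest: antimonoD)

lemma bead_less: "is_partition lam \<Longrightarrow> i < j \<Longrightarrow> bead lam j < bead lam i"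
  using partition_antimono[of lam i j] by (simp add: bead_def)

lemma bead_le_iff: "is_partition lam \<Longrightarrow> bead lam j \<le> bead lam i \<longleftrightarrow> i \<le> j"
  using bead_less by (metis linorder_le_less_linear order_less_imp_le order_le_less not_less)

lemma inj_bead: "is_partition lam \<Longrightarrow> inj (bead lam)"
  by (metis bead_le_iff injI order_antisym order_refl)

lemma partition_zero_tail:
  assumes "is_partition lam"
  shows "\<exists>n. \<forall>i\<ge>n. lam i = 0"
proof -
  obtain n where "\<forall>i \<in> {i. lam i \<noteq> 0}. i < n"
    using assms finite_nat_set_iff_bounded unfolding is_partition_def by blast
  then have "\<forall>i\<ge>n. lam i = 0" by fastforce
  then show ?thesis by blast
qed

lemma finite_bead_ge: "is_partition lam \<Longrightarrow> finite {i. d \<le> bead lam i}"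
proof (rule finite_subset)
  assume lam: "is_partition lam"
  show "{i. d \<le> bead lam i} \<subseteq> {..nat (int (lam 0) - d)}"
  proof
    fix i assume "i \<in> {i. d \<le> bead lam i}"
    moreover have "lam i \<le> lam 0" using lam by (simp add: partition_antimono)
    ultimately show "i \<in> {..nat (int (lam 0) - d)}" by (auto simp: bead_def)
  qed
qed simp

lemma beads_image: "{b \<in> beta_set lam. d \<le> b} = bead lam ` {i. d \<le> bead lam i}"
  by (auto simp: beta_set_eq)

lemma finite_beads_ge: "is_partition lam \<Longrightarrow> finite {b \<in> beta_set lam. d \<le> b}"
  by (simp add: beads_image finite_bead_ge)

lemma less_beads_from_iff:
  assumes "is_partition lam"
  shows "i < beads_from (beta_set lam) d \<longleftrightarrow> d \<le> bead lam i"
proof -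
  have "beads_from (beta_set lam) d = card {i. d \<le> bead lam i}"
    unfolding beads_from_def beads_image
    by (rule card_image) (meson assms inj_bead inj_on_subset subset_UNIV)
  then show ?thesis
    using finite_downset_iff[of "{i. d \<le> bead lam i}" i] finite_bead_ge[OF assms]
      bead_le_iff[OF assms] by (metis mem_Collect_eq order_trans)
qed

text \<open>Both sides say that the bead of row \<open>i\<close> is at least \<open>j - i\<close>.
  The right side mentions only the beta-set, which is why the beta-set determines the partition and
  why bead moves can be read off on diagonals.\<close>

lemma young_diagram_iff:
  assumes "is_partition lam"
  shows "(i, j) \<in> young_diagram lam \<longleftrightarrow> i < beads_from (beta_set lam) (int j - int i)"
  unfolding less_beads_from_iff[OF assms] by (auto simp: young_diagram_def bead_def)

lemma young_diagram_down:
  "is_partition lam \<Longrightarrow> (i, j) \<in> young_diagram lam \<Longrightarrow> i' \<le> i \<Longrightarrow> j' \<le> j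
    \<Longrightarrow> (i', j') \<in> young_diagram lam"
  using partition_antimono[of lam i' i] by (simp add: young_diagram_def)

lemma young_diagram_inject: "young_diagram lam = young_diagram mu \<longleftrightarrow> lam = mu"
proof
  assume *: "young_diagram lam = young_diagram mu"
  have "c < lam r \<longleftrightarrow> c < mu r" for r c
    using * by (auto simp: young_diagram_def set_eq_iff)
  then show "lam = mu" by (metis ext linorder_neqE_nat order_less_irrefl)
qed simp

lemma beta_set_inject:
  assumes "is_partition lam" "is_partition mu" "beta_set lam = beta_set mu"
  shows "lam = mu"
proof -
  have "young_diagram lam = young_diagram mu"
    using young_diagram_iff[OF assms(1)] young_diagram_iff[OF assms(2)] assms(3) by auto
  then show ?thesis by (simp add: young_diagram_inject)
qed

section \<open>Columns, gaps and the conjugate partition\<close>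

lemma less_conjugate_iff:
  assumes "is_partition lam"
  shows "i < conjugate lam c \<longleftrightarrow> c < lam i"
proof -
  have "finite {i. c < lam i}"
    using assms by (auto simp: is_partition_def elim!: finite_subset[rotated])
  moreover have "i \<in> {i. c < lam i}" if "j \<in> {i. c < lam i}" "i \<le> j" for i j
    using that partition_antimono[OF assms, of i j] by simp
  ultimately have "i < card {i. c < lam i} \<longleftrightarrow> i \<in> {i. c < lam i}"
    by (rule finite_downset_iff)
  then show ?thesis by (simp add: conjugate_def)
qed

lemma is_partition_conjugate:
  assumes "is_partition lam"
  shows "is_partition (conjugate lam)"
proof -
  have "antimono (conjugate lam)"
  proof (rule antimonoI)
    fix c d :: nat assume "c \<le> d"
    then have "i < conjugate lam d \<Longrightarrow> i < conjugate lam c" for i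
      by (simp add: less_conjugate_iff[OF assms])
    then show "conjugate lam d \<le> conjugate lam c" by (meson linorder_not_less order_less_irrefl)
  qed
  moreover have "{c. conjugate lam c \<noteq> 0} \<subseteq> {..<lam 0}"
    using less_conjugate_iff[OF assms, of 0] by auto
  ultimately show ?thesis
    unfolding is_partition_def by (meson finite_lessThan finite_subset)
qed

text \<open>If \<open>c < lam i\<close>, then also \<open>i < conjugate lam c\<close>, and the gap
  lies strictly below the bead; otherwise both inequalities fail and it lies strictly above.\<close>

lemma gap_notin:
  assumes "is_partition lam"
  shows "gap lam c \<notin> beta_set lam"
proof
  assume "gap lam c \<in> beta_set lam"
  then obtain i where i: "gap lam c = bead lam i" by (auto simp: beta_set_eq)
  show False
    using i less_conjugate_iff[OF assms, of i c] by (cases "c < lam i") (auto simp: gap_def bead_def)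
qed

text \<open>If \<open>n\<close> beads lie above \<open>g\<close>, a column \<open>c\<close> with
  \<open>gap lam c = g\<close> and height \<open>n\<close> must be \<open>n + g\<close>; the proof
  checks that this column indeed has height \<open>n\<close>.\<close>

lemma gap_surj:
  assumes lam: "is_partition lam" and g: "g \<notin> beta_set lam"
  obtains c where "gap lam c = g"
proof -
  define n where "n = beads_from (beta_set lam) g"
  have n: "i < n \<longleftrightarrow> g < bead lam i" for i
    using less_beads_from_iff[OF lam] g unfolding n_def
    by (metis beta_set_eq order_le_less rangeI)
  \<comment> \<open>The bead of row \<open>n\<close> is below \<open>g\<close>, so
    \<open>n + g\<close> is at least the part \<open>lam n\<close>.\<close>
  have n0: "0 \<le> int n + g"
    using less_beads_from_iff[OF lam, of n g] by (simp add: n_def bead_def)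
  have "i < conjugate lam (nat (int n + g)) \<longleftrightarrow> i < n" for i
  proof -
    have "nat (int n + g) < lam i \<longleftrightarrow> i < n"
    proof
      assume "i < n"
      then obtain m where m: "n = Suc m" by (cases n) auto
      have "lam m \<le> lam i"
        using \<open>i < n\<close> m by (intro partition_antimono[OF lam]) simp
      moreover have "g < bead lam m" using n[of m] m by simp
      ultimately show "nat (int n + g) < lam i" using n0 m by (simp add: bead_def)
    next
      assume *: "nat (int n + g) < lam i"
      show "i < n"
      proof (rule ccontr)
        assume "\<not> i < n"
        then have "lam i \<le> lam n" by (intro partition_antimono[OF lam]) simp
        moreover have "bead lam n < g" using less_beads_from_iff[OF lam, of n g] by (simp add: n_def)
        ultimately show False using * n0 by (simp add: bead_def)
      qed
    qed
    then show ?thesis by (simp add: less_conjugate_iff[OF lam])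
  qed
  then have "conjugate lam (nat (int n + g)) = n" by (metis linorder_neqE_nat order_less_irrefl)
  then have "gap lam (nat (int n + g)) = g" using n0 by (simp add: gap_def)
  then show ?thesis by (rule that)
qed

text \<open>The bead of row \<open>c\<close> of the conjugate is \<open>- 1 - gap lam c\<close>, so
  conjugation reflects the set of gaps into the set of beads.\<close>

lemma beta_set_conjugate:
  assumes "is_partition lam"
  shows "x \<in> beta_set (conjugate lam) \<longleftrightarrow> - 1 - x \<notin> beta_set lam"
proof -
  have "x \<in> beta_set (conjugate lam) \<longleftrightarrow> (\<exists>c. gap lam c = - 1 - x)"
    unfolding beta_set_eq bead_def gap_def image_iff Bex_def by (intro ex_cong1) auto
  also have "\<dots> \<longleftrightarrow> - 1 - x \<notin> beta_set lam"
    using gap_notin[OF assms] gap_surj[OF assms] by metis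
  finally show ?thesis .
qed

lemma conjugate_eq_iff:
  assumes "is_partition lam"
  shows "conjugate lam = lam \<longleftrightarrow> (\<forall>x. x \<in> beta_set lam \<longleftrightarrow> - 1 - x \<notin> beta_set lam)"
proof
  assume "\<forall>x. x \<in> beta_set lam \<longleftrightarrow> - 1 - x \<notin> beta_set lam"
  then have "beta_set (conjugate lam) = beta_set lam"
    using beta_set_conjugate[OF assms] by blast
  then show "conjugate lam = lam" by (rule beta_set_inject[OF is_partition_conjugate[OF assms] assms])
next
  assume eq: "conjugate lam = lam"
  show "\<forall>x. x \<in> beta_set lam \<longleftrightarrow> - 1 - x \<notin> beta_set lam"
    using beta_set_conjugate[OF assms] unfolding eq by blast
qed

section \<open>Rim hooks as bead moves\<close>

text \<open>The rim meets a diagonal in its last box only, whose row is the bead count minus one.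
  Once the box is known to be the last one, lying below row \<open>r\<close> and to the right of
  column \<open>c\<close> depends on its content alone.\<close>

lemma rim_hook_iff:
  assumes lam: "is_partition lam"
  shows "(i, j) \<in> rim_hook lam (r, c) \<longleftrightarrow>
    gap lam c < int j - int i \<and> int j - int i \<le> bead lam r \<and>
    beads_from (beta_set lam) (int j - int i) = i + 1"
    (is "?L \<longleftrightarrow> ?R")
proof
  assume L: ?L
  then have ij: "(i, j) \<in> young_diagram lam" "r \<le> i" "c \<le> j"
    "(i + 1, j + 1) \<notin> young_diagram lam" by (auto simp: rim_hook_def)
  then have n: "beads_from (beta_set lam) (int j - int i) = i + 1"
    by (simp add: young_diagram_iff[OF lam])
  moreover have "int j - int i \<le> bead lam r"
    using less_beads_from_iff[OF lam, of r "int j - int i"] \<open>r \<le> i\<close> by (simp add: n)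
  \<comment> \<open>The box of column \<open>c\<close> on the diagonal through \<open>(i, j)\<close>
    has row \<open>i + c - j\<close>; it is in the diagram because it lies weakly above and to the
    left of \<open>(i, j)\<close>. If that row would be negative, the content already exceeds
    \<open>c\<close>.\<close>
  moreover have "gap lam c < int j - int i"
  proof (cases "j \<le> i + c")
    case True
    then have "(i + c - j, c) \<in> young_diagram lam"
      using ij by (auto intro: young_diagram_down[OF lam])
    then have "i + c - j < conjugate lam c"
      by (simp add: less_conjugate_iff[OF lam] young_diagram_def)
    then show ?thesis using True by (simp add: gap_def)
  qed (simp add: gap_def)
  ultimately show ?R by simp
next
  assume R: ?R
  then have R: "gap lam c < int j - int i" "int j - int i \<le> bead lam r"
    and n: "beads_from (beta_set lam) (int j - int i) = i + 1" by simp_all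
  then have ij: "(i, j) \<in> young_diagram lam" "(i + 1, j + 1) \<notin> young_diagram lam"
    by (simp_all add: young_diagram_iff[OF lam])
  have "r \<le> i" using R n less_beads_from_iff[OF lam, of r "int j - int i"] by simp
  moreover have "c \<le> j"
  proof (rule ccontr)
    assume "\<not> c \<le> j"
    then have "i + c - j < conjugate lam c" using R(1) by (simp add: gap_def)
    then have "(i + c - j, c) \<in> young_diagram lam"
      by (simp add: less_conjugate_iff[OF lam] young_diagram_def)
    moreover have "int c - int (i + c - j) = int j - int i" using \<open>\<not> c \<le> j\<close> by simp
    ultimately have "i + c - j < i + 1" using young_diagram_iff[OF lam] n by metis
    then show False using \<open>\<not> c \<le> j\<close> by simp
  qed
  ultimately show ?L using ij by (auto simp: rim_hook_def)
qed

text \<open>The content maps the rim hook bijectively onto an interval, since every diagonal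
  strictly above the gap and up to the bead meets the rim exactly once.\<close>

lemma card_rim_hook:
  assumes lam: "is_partition lam" and rc: "(r, c) \<in> young_diagram lam"
  shows "int (card (rim_hook lam (r, c))) = bead lam r - gap lam c"
proof -
  have "bij_betw (\<lambda>(i, j). int j - int i) (rim_hook lam (r, c)) {gap lam c<..bead lam r}"
  proof (rule bij_betw_imageI)
    show "inj_on (\<lambda>(i, j). int j - int i) (rim_hook lam (r, c))"
    proof (rule inj_onI, clarify)
      fix i j i' j' :: nat
      assume "(i, j) \<in> rim_hook lam (r, c)" "(i', j') \<in> rim_hook lam (r, c)"
        and eq: "int j - int i = int j' - int i'"
      then have "beads_from (beta_set lam) (int j - int i) = i + 1"
        "beads_from (beta_set lam) (int j' - int i') = i' + 1"
        unfolding rim_hook_iff[OF lam] by blast+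
      then have "i = i'" unfolding eq by linarith
      then show "i = i' \<and> j = j'" using eq by simp
    qed
    show "(\<lambda>(i, j). int j - int i) ` rim_hook lam (r, c) = {gap lam c<..bead lam r}" (is "?f ` ?H = ?I")
    proof
      show "?f ` ?H \<subseteq> ?I" by (auto simp: rim_hook_iff[OF lam])
      show "?I \<subseteq> ?f ` ?H"
      proof
        fix d assume d: "d \<in> ?I"
        define i where "i = beads_from (beta_set lam) d - 1"
        have i: "beads_from (beta_set lam) d = i + 1"
          using less_beads_from_iff[OF lam, of r d] d by (auto simp: i_def)
        \<comment> \<open>\<open>i + d\<close> is the column of the last box on diagonal
          \<open>d\<close>. For \<open>d \<le> c\<close>, the box of column \<open>c\<close> on this
          diagonal is in the diagram, so the last box has row at least \<open>c - d\<close>.\<close>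
        have "0 \<le> int i + d"
        proof (cases "d \<le> int c")
          case True
          then have "nat (int c - d) < conjugate lam c" using d by (simp add: gap_def nat_less_iff)
          then have "(nat (int c - d), c) \<in> young_diagram lam"
            by (simp add: less_conjugate_iff[OF lam] young_diagram_def)
          then show ?thesis using young_diagram_iff[OF lam] True i by auto
        qed simp
        then obtain j where j: "int j = int i + d" by (metis nonneg_int_cases)
        then have "int j - int i = d" by simp
        moreover from this have "(i, j) \<in> ?H" using d i unfolding rim_hook_iff[OF lam] by simp
        ultimately show "d \<in> ?f ` ?H" by (intro image_eqI[where x = "(i, j)"]) simp_all
      qed
    qed
  qed
  then have "card (rim_hook lam (r, c)) = card {gap lam c<..bead lam r}" by (rule bij_betw_same_card)
  moreover have "gap lam c \<le> bead lam r"
    using rc less_conjugate_iff[OF lam, of r c] by (auto simp: young_diagram_def gap_def bead_def)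
  ultimately show ?thesis by simp
qed

lemma exists_hook:
  assumes lam: "is_partition lam" and "b \<in> beta_set lam" "g \<notin> beta_set lam" "g < b"
  obtains r c where "(r, c) \<in> young_diagram lam" "bead lam r = b" "gap lam c = g"
proof -
  obtain r where r: "bead lam r = b" using assms(2) by (auto simp: beta_set_eq)
  obtain c where c: "gap lam c = g" using gap_surj[OF lam assms(3)] .
  have "(r, c) \<in> young_diagram lam"
    using r c assms(4) less_conjugate_iff[OF lam, of r c]
    by (cases "c < lam r") (auto simp: young_diagram_def gap_def bead_def)
  then show ?thesis using that r c by blast
qed

text \<open>Hook lengths are the differences between a bead and a smaller gap, so a hook of length
  \<open>s\<close> is a bead whose position lowered by \<open>s\<close> is vacant.\<close>

lemma cores_iff:
  assumes "s \<ge> 1"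
  shows "lam \<in> cores s \<longleftrightarrow> is_partition lam \<and> (\<forall>b \<in> beta_set lam. b - int s \<in> beta_set lam)"
proof (cases "is_partition lam")
  case lam: True
  have "(\<exists>x \<in> young_diagram lam. card (rim_hook lam x) = s) \<longleftrightarrow>
    (\<exists>b \<in> beta_set lam. b - int s \<notin> beta_set lam)" (is "?L \<longleftrightarrow> ?R")
  proof
    assume ?L
    then obtain r c where "(r, c) \<in> young_diagram lam" "card (rim_hook lam (r, c)) = s" by auto
    then have "gap lam c = bead lam r - int s" using card_rim_hook[OF lam] by fastforce
    then show ?R using gap_notin[OF lam, of c] by (auto simp: beta_set_eq)
  next
    assume ?R
    then obtain b where "b \<in> beta_set lam" "b - int s \<notin> beta_set lam" by auto
    then obtain r c where rc: "(r, c) \<in> young_diagram lam" "bead lam r = b" "gap lam c = b - int s"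
      using exists_hook[OF lam, of b "b - int s"] assms by auto
    then have "card (rim_hook lam (r, c)) = s" using card_rim_hook[OF lam, of r c] by simp
    then show ?L using rc(1) by blast
  qed
  then show ?thesis using lam by (auto simp: cores_def)
qed (simp add: cores_def)

section \<open>Partitions from beta-sets\<close>

text \<open>Bounds on both sides make \<open>B\<close> a decreasing sequence that is eventually
  consecutive. The charge condition fixes the remaining translation, so that the \<open>i\<close>-th
  term is eventually \<open>- i - 1\<close>, the bead of a zero part.\<close>

lemma exists_partition:
  assumes bound: "\<And>b. b \<in> B \<Longrightarrow> b \<le> M" and tail: "\<And>x. x < d \<Longrightarrow> x \<in> B"
    and charge: "int (beads_from B d) = - d"
  obtains lam where "is_partition lam" "beta_set lam = B"
proof -
  \<comment> \<open>Reflection at the upper bound turns the decreasing listing of \<open>B\<close>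
    into the increasing enumeration of an infinite set of naturals.\<close>
  define A where "A = {n :: nat. M - int n \<in> B}"
  have "{nat (M - d) + 1..} \<subseteq> A" by (auto simp: A_def intro!: tail)
  then have inf: "infinite A" using infinite_Ici infinite_super by blast
  define f where "f i = M - int (enumerate A i)" for i
  have f_less: "f j < f i \<longleftrightarrow> i < j" for i j
    using inf by (simp add: f_def)
  have range_f: "range f = B"
  proof
    show "range f \<subseteq> B" using enumerate_in_set[OF inf] by (auto simp: f_def A_def)
    show "B \<subseteq> range f"
    proof
      fix b assume "b \<in> B"
      then have "nat (M - b) \<in> A" using bound by (auto simp: A_def)
      then obtain n where "enumerate A n = nat (M - b)" using enumerate_Ex[OF inf] by auto
      then have "f n = b" using bound[OF \<open>b \<in> B\<close>] by (simp add: f_def)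
      then show "b \<in> range f" by auto
    qed
  qed
  have count: "card {x \<in> B. f i < x} = i" for i
  proof -
    have "{x \<in> B. f i < x} = f ` {..<i}" using f_less by (auto simp: range_f[symmetric])
    moreover have "inj_on f {..<i}" by (rule inj_onI) (metis f_less less_irrefl linorder_neqE_nat)
    ultimately show ?thesis by (simp add: card_image)
  qed
  \<comment> \<open>By the charge condition exactly \<open>i\<close> elements of \<open>B\<close>
    exceed \<open>- i - 1\<close>, and an element of \<open>B\<close> is identified by the number of
    larger ones.\<close>
  have f_tail: "f i = - int i - 1" if "- d \<le> int i" for i
  proof -
    have "{x \<in> B. - int i - 1 < x} = {x \<in> B. d \<le> x} \<union> {- int i..<d}"
      using that by (auto intro: tail)
    moreover have "finite {x \<in> B. d \<le> x}"
      by (rule finite_subset[of _ "{d..M}"]) (auto intro: bound)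
    moreover have "{x \<in> B. d \<le> x} \<inter> {- int i..<d} = {}" by auto
    ultimately have "card {x \<in> B. - int i - 1 < x} = beads_from B d + nat (d + int i)"
      by (simp add: card_Un_disjoint beads_from_def)
    then have "card {x \<in> B. - int i - 1 < x} = i" using charge that by simp
    moreover have "- int i - 1 \<in> range f" using tail[of "- int i - 1"] that range_f by simp
    then obtain j where "f j = - int i - 1" by auto
    ultimately show ?thesis using count[of j] by metis
  qed
  define lam where "lam i = nat (f i + int i + 1)" for i
  have step: "f (Suc i) + 1 \<le> f i" for i using f_less[of "Suc i" i] by simp
  have anti: "f (i + k) + int k \<le> f i" for i k
  proof (induction k)
    case (Suc k)
    then show ?case using step[of "i + k"] by simp
  qed simp
  \<comment> \<open>\<open>f i + i + 1\<close> is weakly decreasing in \<open>i\<close> and reaches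
    0 in the tail.\<close>
  have nonneg: "0 \<le> f i + int i + 1" for i
    using anti[of i "nat (- d)"] f_tail[of "i + nat (- d)"] by simp
  have bead: "bead lam = f"
    using nonneg by (auto simp: bead_def lam_def)
  have "is_partition lam"
    unfolding is_partition_def
  proof
    show "antimono lam"
    proof (rule antimonoI)
      fix i j :: nat assume "i \<le> j"
      then show "lam j \<le> lam i" using anti[of i "j - i"] by (auto simp: lam_def intro!: nat_mono)
    qed
    have "{i. lam i \<noteq> 0} \<subseteq> {..<nat (- d)}"
      by (rule subsetI, rule ccontr) (use f_tail in \<open>auto simp: lam_def\<close>)
    then show "finite {i. lam i \<noteq> 0}" using finite_subset by blast
  qed
  moreover have "beta_set lam = B" by (simp add: beta_set_eq bead range_f)
  ultimately show ?thesis by (rule that)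
qed

lemma beta_set_bounded:
  assumes "is_partition lam" and "b \<in> beta_set lam"
  shows "b < int (lam 0)"
proof -
  obtain i where "b = bead lam i" using assms(2) by (auto simp: beta_set_eq)
  then show ?thesis
    using partition_antimono[OF assms(1), of 0 i] by (simp add: bead_def)
qed

text \<open>Beyond the last nonzero part the beads are consecutive. The count is given for every low
  cut-off so that the cut-off can be lowered further when a bead moves.\<close>

lemma beta_set_tail:
  assumes "is_partition lam"
  shows "\<exists>d. (\<forall>x<d. x \<in> beta_set lam) \<and>
    (\<forall>e\<le>d. int (beads_from (beta_set lam) e) = - e)"
proof -
  obtain n where n: "\<And>i. i \<ge> n \<Longrightarrow> lam i = 0" using partition_zero_tail[OF assms] by blast
  show ?thesis
  proof (intro exI[of _ "- int n"] conjI allI impI)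
    fix x assume "x < - int n"
    then have "bead lam (nat (- x - 1)) = x" using n[of "nat (- x - 1)"] by (simp add: bead_def)
    then show "x \<in> beta_set lam" by (metis beta_set_eq rangeI)
  next
    fix e assume e: "e \<le> - int n"
    have "i < beads_from (beta_set lam) e \<longleftrightarrow> i < nat (- e)" for i
    proof (cases "n \<le> i")
      case True
      then show ?thesis using e n[of i] by (auto simp: less_beads_from_iff[OF assms] bead_def)
    next
      case False
      then show ?thesis using e by (auto simp: less_beads_from_iff[OF assms] bead_def)
    qed
    then have "beads_from (beta_set lam) e = nat (- e)"
      by (metis linorder_neqE_nat order_less_irrefl)
    then show "int (beads_from (beta_set lam) e) = - e" using e by simp
  qed
qed

lemma finite_young_diagram:
  assumes "is_partition lam" shows "finite (young_diagram lam)"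
proof -
  obtain n where n: "\<And>i. i \<ge> n \<Longrightarrow> lam i = 0" using partition_zero_tail[OF assms] by blast
  have "young_diagram lam \<subseteq> {..<n} \<times> {..<lam 0}"
  proof (clarsimp simp: young_diagram_def)
    fix i j assume "j < lam i"
    moreover have "lam i \<le> lam 0" using assms by (simp add: partition_antimono)
    ultimately show "i < n \<and> j < lam 0" using n[of i] by (cases "n \<le> i") auto
  qed
  then show ?thesis by (rule finite_subset) simp
qed

section \<open>Moving one bead into a smaller gap\<close>

lemma beads_from_move:
  assumes "finite {x \<in> B. d \<le> x}" "b \<in> B" "g \<notin> B" "g < b"
  shows "beads_from B d =
    beads_from (insert g (B - {b})) d + (if g < d \<and> d \<le> b then 1 else 0)"
proof -
  let ?X = "{x \<in> B. d \<le> x}" and ?Y = "{x \<in> insert g (B - {b}). d \<le> x}"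
  consider "d \<le> g" | "g < d" "d \<le> b" | "b < d" by linarith
  then have "card ?X = card ?Y + (if g < d \<and> d \<le> b then 1 else 0)"
  proof cases
    case 1
    then have "?Y = insert g (?X - {b})" "b \<in> ?X" using assms by auto
    then show ?thesis using 1 assms card_Suc_Diff1[of ?X b] by (simp add: card_insert_if)
  next
    case 2
    then have "?Y = ?X - {b}" "b \<in> ?X" using assms by auto
    then show ?thesis using 2 assms card_Suc_Diff1[of ?X b] by simp
  next
    case 3
    then have "?Y = ?X" using assms by auto
    then show ?thesis using 3 by simp
  qed
  then show ?thesis by (simp add: beads_from_def)
qed

text \<open>Moving the bead into the gap lowers the count by one on exactly the contents occupied by
  the rim hook, so each of those diagonals loses its last box and no other diagonal changes.\<close>

lemma exists_hook_removal:
  assumes lam: "is_partition lam" and rc: "(r, c) \<in> young_diagram lam"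
  obtains mu where "is_partition mu"
    "beta_set mu = insert (gap lam c) (beta_set lam - {bead lam r})"
    "young_diagram mu = young_diagram lam - rim_hook lam (r, c)"
proof -
  define B where "B = beta_set lam"
  define b g where "b = bead lam r" and "g = gap lam c"
  have b: "b \<in> B" by (simp add: B_def b_def beta_set_eq)
  have g: "g \<notin> B" using gap_notin[OF lam] by (simp add: B_def g_def)
  have less: "g < b"
    using rc less_conjugate_iff[OF lam, of r c]
    by (simp add: young_diagram_def g_def b_def gap_def bead_def)
  define B' where "B' = insert g (B - {b})"
  have move: "beads_from B d = beads_from B' d + (if g < d \<and> d \<le> b then 1 else 0)" for d
    unfolding B'_def by (intro beads_from_move b g less) (simp add: B_def finite_beads_ge lam)
  obtain d where tail: "\<And>x. x < d \<Longrightarrow> x \<in> B"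
    and charge: "\<And>e. e \<le> d \<Longrightarrow> int (beads_from B e) = - e"
    using beta_set_tail[OF lam, folded B_def] by blast
  \<comment> \<open>At or below the new position \<open>g\<close> the move is invisible to the
    count, so the charge condition carries over.\<close>
  define d' where "d' = min d g"
  obtain mu where mu: "is_partition mu" "beta_set mu = B'"
  proof (rule exists_partition)
    show "x \<le> max (int (lam 0)) g" if "x \<in> B'" for x
      using that beta_set_bounded[OF lam, of x] by (auto simp: B'_def B_def)
    show "x \<in> B'" if "x < d'" for x
      using that tail[of x] less by (auto simp: B'_def d'_def)
    show "int (beads_from B' d') = - d'"
      using charge[of d'] move[of d'] by (simp add: d'_def)
  qed
  have "young_diagram mu = young_diagram lam - rim_hook lam (r, c)"
  proof (rule Set.set_eqI)
    fix x :: "nat \<times> nat"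
    obtain i j where x: "x = (i, j)" by force
    show "x \<in> young_diagram mu \<longleftrightarrow> x \<in> young_diagram lam - rim_hook lam (r, c)"
      using move[of "int j - int i"]
      unfolding x Diff_iff young_diagram_iff[OF mu(1)] young_diagram_iff[OF lam] rim_hook_iff[OF lam]
        mu(2) B_def[symmetric] b_def[symmetric] g_def[symmetric]
      by (auto split: if_splits)
  qed
  then show ?thesis using that mu by (simp add: B'_def B_def b_def g_def)
qed

lemma remove_rim_hook_beta:
  assumes "remove_rim_hook t lam mu"
  obtains b where "b \<in> beta_set lam" "b - int t \<notin> beta_set lam"
    "beta_set mu = insert (b - int t) (beta_set lam - {b})"
proof -
  obtain r c where lam: "is_partition lam" and mu: "is_partition mu"
    and rc: "(r, c) \<in> young_diagram lam" and t: "card (rim_hook lam (r, c)) = t"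
    and yd: "young_diagram mu = young_diagram lam - rim_hook lam (r, c)"
    using assms unfolding remove_rim_hook_def by auto
  obtain nu where "beta_set nu = insert (gap lam c) (beta_set lam - {bead lam r})"
    "young_diagram nu = young_diagram lam - rim_hook lam (r, c)"
    using exists_hook_removal[OF lam rc] by metis
  then have "beta_set mu = insert (gap lam c) (beta_set lam - {bead lam r})"
    using yd young_diagram_inject by metis
  moreover have "gap lam c = bead lam r - int t" using card_rim_hook[OF lam rc] t by simp
  ultimately show ?thesis
    using that[of "bead lam r"] gap_notin[OF lam, of c] by (simp add: beta_set_eq)
qed

lemma exists_core:
  assumes "is_partition lam" and "t \<ge> 1"
  shows "\<exists>mu. (remove_rim_hook t)\<^sup>*\<^sup>* lam mu \<and> mu \<in> cores t"
  using assms(1)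
proof (induction "card (young_diagram lam)" arbitrary: lam rule: less_induct)
  case less
  show ?case
  proof (cases "lam \<in> cores t")
    case False
    then obtain r c where rc: "(r, c) \<in> young_diagram lam" "card (rim_hook lam (r, c)) = t"
      using less.prems by (auto simp: cores_def)
    obtain nu where nu: "is_partition nu"
      "young_diagram nu = young_diagram lam - rim_hook lam (r, c)"
      using exists_hook_removal[OF less.prems rc(1)] by metis
    then have step: "remove_rim_hook t lam nu"
      using less.prems rc by (auto simp: remove_rim_hook_def)
    have "rim_hook lam (r, c) \<subseteq> young_diagram lam" by (auto simp: rim_hook_def)
    moreover have "rim_hook lam (r, c) \<noteq> {}" using rc(2) assms(2) by auto
    ultimately have "card (young_diagram nu) < card (young_diagram lam)"
      using nu(2) finite_young_diagram[OF less.prems] by (intro psubset_card_mono) auto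
    then obtain mu where "(remove_rim_hook t)\<^sup>*\<^sup>* nu mu" "mu \<in> cores t"
      using less.hyps nu(1) by blast
    then show ?thesis using step by (meson converse_rtranclp_into_rtranclp)
  qed auto
qed

section \<open>Cores and residue classes\<close>

text \<open>A residue class contains infinitely many beads, hence the cut-off \<open>e\<close>;
  counts of two beta-sets are compared for all sufficiently low cut-offs.\<close>

definition class_beads_from :: "nat \<Rightarrow> int set \<Rightarrow> int \<Rightarrow> int \<Rightarrow> nat" where
  "class_beads_from t B i e = card {b \<in> B. e \<le> b \<and> [b = i] (mod int t)}"

text \<open>A removal moves a bead by \<open>t\<close>, hence within its class, and a cut-off at or
  below the new position sees both ends of the move. The bound \<open>d\<close> depends on the
  sequence of removals.\<close>

lemma class_beads_from_rim_hooks: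
  assumes "(remove_rim_hook t)\<^sup>*\<^sup>* lam mu" and "is_partition lam"
  shows "\<exists>d. \<forall>e\<le>d. \<forall>i. class_beads_from t (beta_set mu) i e = class_beads_from t (beta_set lam) i e"
  using assms
proof (induction rule: rtranclp_induct)
  case (step mu nu)
  then obtain d where d: "\<And>e i. e \<le> d \<Longrightarrow>
      class_beads_from t (beta_set mu) i e = class_beads_from t (beta_set lam) i e" by blast
  have mu: "is_partition mu" using step.hyps(2) by (simp add: remove_rim_hook_def)
  obtain b where b: "b \<in> beta_set mu" "b - int t \<notin> beta_set mu"
    "beta_set nu = insert (b - int t) (beta_set mu - {b})"
    using remove_rim_hook_beta[OF step.hyps(2)] .
  have "class_beads_from t (beta_set nu) i e = class_beads_from t (beta_set mu) i e"
    if "e \<le> b - int t" for e i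
  proof -
    let ?X = "{b \<in> beta_set mu. e \<le> b \<and> [b = i] (mod int t)}"
    let ?Y = "{b \<in> beta_set nu. e \<le> b \<and> [b = i] (mod int t)}"
    have fin: "finite ?X"
      by (rule finite_subset[OF _ finite_beads_ge[OF mu, of e]]) auto
    have iff: "[b - int t = i] (mod int t) \<longleftrightarrow> [b = i] (mod int t)" by (simp add: cong_def)
    show ?thesis
    proof (cases "[b = i] (mod int t)")
      case True
      then have "?Y = insert (b - int t) (?X - {b})" "b \<in> ?X"
        using that b iff by auto
      then show ?thesis
        using fin b card_Suc_Diff1[of ?X b] by (simp add: class_beads_from_def card_insert_if)
    next
      case False
      then have "?Y = ?X" using b iff by auto
      then show ?thesis by (simp add: class_beads_from_def)
    qed
  qed
  then have "\<forall>e\<le>min d (b - int t). \<forall>i.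
      class_beads_from t (beta_set nu) i e = class_beads_from t (beta_set lam) i e"
    using d by simp
  then show ?case by blast
qed auto

lemma exists_cong_le:
  assumes "t \<ge> 1"
  obtains e :: int where "e \<le> M" "[e = i] (mod int t)"
proof (rule that[of "i - int t * (\<bar>i\<bar> + \<bar>M\<bar>)"])
  have "\<bar>i\<bar> + \<bar>M\<bar> \<le> int t * (\<bar>i\<bar> + \<bar>M\<bar>)"
    using assms mult_right_mono[of 1 "int t" "\<bar>i\<bar> + \<bar>M\<bar>"] by simp
  then show "i - int t * (\<bar>i\<bar> + \<bar>M\<bar>) \<le> M" by linarith
  show "[i - int t * (\<bar>i\<bar> + \<bar>M\<bar>) = i] (mod int t)" by (simp add: cong_iff_dvd_diff)
qed

section \<open>Residue classes of a core and uniqueness of the core\<close>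

lemma Greatest_int:
  fixes P :: "int \<Rightarrow> bool"
  assumes "P a" and "\<And>b. P b \<Longrightarrow> b \<le> M"
  shows "P (Greatest P)" and "P b \<Longrightarrow> b \<le> Greatest P"
proof -
  let ?S = "{b. P b \<and> a \<le> b}"
  have fin: "finite ?S" by (rule finite_subset[of _ "{a..M}"]) (auto simp: assms(2))
  have max: "Max ?S \<in> ?S" by (rule Max_in[OF fin]) (use assms(1) in auto)
  have le: "b \<le> Max ?S" if "P b" for b
    using that Max_ge[OF fin, of b] max by (cases "a \<le> b") auto
  then have "Greatest P = Max ?S" using max by (intro Greatest_equality) auto
  then show "P (Greatest P)" and "P b \<Longrightarrow> b \<le> Greatest P" using max le by auto
qed

lemma core_downward:
  assumes "mu \<in> cores t" and "t \<ge> 1" and "b \<in> beta_set mu"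
  shows "b - int n * int t \<in> beta_set mu"
proof (induction n)
  case (Suc n)
  then have "b - int n * int t - int t \<in> beta_set mu" using assms cores_iff by blast
  then show ?case by (simp add: algebra_simps)
qed (simp add: assms)

lemma cong_diff_multiple:
  fixes a b :: int
  assumes "[a = b] (mod int t)" and "a \<le> b" and "t \<ge> 1"
  obtains n where "b = a + int n * int t"
proof -
  obtain k where k: "b = a + int t * k" using assms(1) by (metis cong_iff_lin)
  then have "0 \<le> k" using assms(2,3) by (simp add: zero_le_mult_iff)
  then have "b = a + int (nat k) * int t" using k by simp
  then show ?thesis by (rule that)
qed

text \<open>In a \<open>t\<close>-core the beads of a residue class have no vacancy below them, so
  the coordinate, one step above the greatest bead, is the first vacant position of the
  class.\<close>

lemma core_beta_set_iff:
  assumes mu: "mu \<in> cores t" and t: "t \<ge> 1" and bi: "[b = i] (mod int t)"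
  shows "b \<in> beta_set mu \<longleftrightarrow> b < a_coord t mu i"
proof -
  define P where "P = (\<lambda>b. b \<in> beta_set mu \<and> [b = i] (mod int t))"
  define g where "g = Greatest P"
  have part: "is_partition mu" using mu by (simp add: cores_def)
  obtain d where tail: "\<And>x. x < d \<Longrightarrow> x \<in> beta_set mu" using beta_set_tail[OF part] by blast
  obtain x where "x \<le> d - 1" "[x = i] (mod int t)" using exists_cong_le[OF t] .
  then have "P x" using tail by (simp add: P_def)
  then have g: "P g" and max: "\<And>b. P b \<Longrightarrow> b \<le> g"
    using Greatest_int[of P x "int (mu 0)"] beta_set_bounded[OF part] unfolding g_def P_def
    by (auto simp: less_imp_le)
  have a: "a_coord t mu i = int t + g" by (simp add: a_coord_def g_def P_def)
  show ?thesis
  proof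
    assume "b \<in> beta_set mu"
    then show "b < a_coord t mu i" using max[of b] bi a t by (simp add: P_def)
  next
    assume "b < a_coord t mu i"
    then have lt: "b < g + int t" by (simp add: a)
    have cong: "[b = g + int t] (mod int t)" using bi g by (simp add: P_def cong_def)
    obtain n where n: "g + int t = b + int n * int t"
      using cong_diff_multiple[OF cong _ t] lt by auto
    with lt obtain m where "n = Suc m" by (cases n) auto
    then have "b = g - int m * int t" using n by (simp add: algebra_simps)
    then show "b \<in> beta_set mu" using core_downward[OF mu t] g by (simp add: P_def)
  qed
qed

text \<open>The counted beads are \<open>e\<close>, \<open>e + t\<close>, and so on up to
  \<open>a_coord t mu i - t\<close>, without a hole.\<close>

lemma core_class_beads_from:
  assumes mu: "mu \<in> cores t" and t: "t \<ge> 1" and ei: "[e = i] (mod int t)"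
    and le: "e \<le> a_coord t mu i"
  shows "int t * int (class_beads_from t (beta_set mu) i e) = a_coord t mu i - e"
proof -
  let ?a = "a_coord t mu i"
  have part: "is_partition mu" using mu by (simp add: cores_def)
  have "[e = ?a] (mod int t)" using a_coord_cong[OF part t, of i] ei by (simp add: cong_def)
  then obtain n where n: "?a = e + int n * int t" using cong_diff_multiple le t by metis
  have "{b \<in> beta_set mu. e \<le> b \<and> [b = i] (mod int t)} = (\<lambda>m. e + int m * int t) ` {..<n}" (is "?X = ?Y")
  proof
    show "?X \<subseteq> ?Y"
    proof
      fix b assume b: "b \<in> ?X"
      then have lt: "b < ?a" using core_beta_set_iff[OF mu t, of b i] by simp
      have "[e = b] (mod int t)" using b ei by (simp add: cong_def)
      then obtain m where m: "b = e + int m * int t" using cong_diff_multiple b t by blast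
      then have "m < n" using lt n by (simp add: mult_less_cancel_right)
      then show "b \<in> ?Y" using m by auto
    qed
    show "?Y \<subseteq> ?X"
    proof clarsimp
      fix m assume "m < n"
      then have "e + int m * int t < ?a" using n t by (simp add: mult_less_cancel_right)
      moreover have "[e + int m * int t = i] (mod int t)" using ei by (simp add: cong_def)
      ultimately show "e + int m * int t \<in> beta_set mu \<and> [e + int m * int t = i] (mod int t)"
        using core_beta_set_iff[OF mu t] by simp
    qed
  qed
  moreover have "inj_on (\<lambda>m. e + int m * int t) {..<n}" using t by (auto intro: inj_onI)
  ultimately have "class_beads_from t (beta_set mu) i e = n"
    by (simp add: class_beads_from_def card_image)
  then show ?thesis using n by simp
qed

text \<open>Both removal sequences preserve the class counts of \<open>lam\<close>, and these counts
  determine every coordinate and hence the beta-set of a \<open>t\<close>-core.\<close>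

lemma core_unique:
  assumes lam: "is_partition lam" and t: "t \<ge> 1"
    and mu: "(remove_rim_hook t)\<^sup>*\<^sup>* lam mu" "mu \<in> cores t"
    and nu: "(remove_rim_hook t)\<^sup>*\<^sup>* lam nu" "nu \<in> cores t"
  shows "mu = nu"
proof -
  obtain d d' where d: "\<And>e i. e \<le> d \<Longrightarrow>
      class_beads_from t (beta_set mu) i e = class_beads_from t (beta_set lam) i e"
    and d': "\<And>e i. e \<le> d' \<Longrightarrow>
      class_beads_from t (beta_set nu) i e = class_beads_from t (beta_set lam) i e"
    using class_beads_from_rim_hooks[OF mu(1) lam] class_beads_from_rim_hooks[OF nu(1) lam] by metis
  have "a_coord t mu i = a_coord t nu i" for i
  proof -
    obtain e where e: "e \<le> min (min d d') (min (a_coord t mu i) (a_coord t nu i))"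
      "[e = i] (mod int t)" using exists_cong_le[OF t] .
    then have "a_coord t mu i - e = a_coord t nu i - e"
      using d[of e i] d'[of e i] core_class_beads_from[OF mu(2) t e(2)]
        core_class_beads_from[OF nu(2) t e(2)] by simp
    then show ?thesis by simp
  qed
  then have "beta_set mu = beta_set nu"
    using core_beta_set_iff[OF mu(2) t cong_refl] core_beta_set_iff[OF nu(2) t cong_refl] by auto
  then show ?thesis using beta_set_inject mu(2) nu(2) by (simp add: cores_def)
qed

lemma core_of:
  assumes lam: "is_partition lam" and t: "t \<ge> 1"
  shows "(remove_rim_hook t)\<^sup>*\<^sup>* lam (core_of t lam)" and "core_of t lam \<in> cores t"
proof -
  have "\<exists>!mu. (remove_rim_hook t)\<^sup>*\<^sup>* lam mu \<and> mu \<in> cores t"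
    using exists_core[OF lam t] core_unique[OF lam t] by blast
  from theI'[OF this] show "(remove_rim_hook t)\<^sup>*\<^sup>* lam (core_of t lam)" "core_of t lam \<in> cores t"
    by (simp_all add: core_of_def)
qed

text \<open>For an \<open>s\<close>-core with beta-set \<open>B\<close>, the set
  \<open>B + s\<close> is the disjoint union of \<open>B\<close> and the \<open>s\<close>-set.
  Restricted to one class above a low cut-off, this compares two finite bead counts of
  \<open>lam\<close>, which agree with those of its \<open>t\<close>-core.\<close>

lemma card_s_set_class:
  assumes lam: "lam \<in> cores s" and s: "s \<ge> 1" and t: "t \<ge> 1"
  shows "int t * int (card {x \<in> s_set s lam. [x = i + int s] (mod int t)}) =
    a_coord t (core_of t lam) i - (a_coord t (core_of t lam) (i + int s) - int s)"
proof -
  define mu where "mu = core_of t lam"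
  define B where "B = beta_set lam"
  have part: "is_partition lam" and down: "\<And>b. b \<in> B \<Longrightarrow> b - int s \<in> B"
    using lam s by (auto simp: cores_iff B_def)
  have mu: "(remove_rim_hook t)\<^sup>*\<^sup>* lam mu" "mu \<in> cores t"
    using core_of[OF part t] by (auto simp: mu_def)
  obtain d where d: "\<And>e i. e \<le> d \<Longrightarrow> class_beads_from t (beta_set mu) i e = class_beads_from t B i e"
    using class_beads_from_rim_hooks[OF mu(1) part] unfolding B_def by blast
  obtain d0 where tail: "\<And>x. x < d0 \<Longrightarrow> x \<in> B"
    using beta_set_tail[OF part, folded B_def] by blast
  \<comment> \<open>Subtracting \<open>s\<close> makes both cut-offs \<open>e\<close> and
    \<open>e + s\<close> low enough.\<close>
  obtain e where e: "e \<le> min (min d d0) (min (a_coord t mu i) (a_coord t mu (i + int s))) - int s"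
    "[e = i] (mod int t)" using exists_cong_le[OF t] .
  then have es: "[e + int s = i + int s] (mod int t)" by (simp add: cong_add)
  let ?S = "{x \<in> s_set s lam. [x = i + int s] (mod int t)}"
  let ?X = "{b \<in> B. e \<le> b \<and> [b = i] (mod int t)}"
  let ?Y = "{b \<in> B. e + int s \<le> b \<and> [b = i + int s] (mod int t)}"
  have shift: "[b + int s = i + int s] (mod int t) \<longleftrightarrow> [b = i] (mod int t)" for b
    by (simp add: cong_add_rcancel)
  have "(\<lambda>b. b + int s) ` ?X = ?S \<union> ?Y"
  proof
    show "(\<lambda>b. b + int s) ` ?X \<subseteq> ?S \<union> ?Y"
      by (auto simp: s_set_def B_def shift)
    show "?S \<union> ?Y \<subseteq> (\<lambda>b. b + int s) ` ?X"
    proof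
      fix x assume x: "x \<in> ?S \<union> ?Y"
      then have "x - int s \<in> B" using down by (auto simp: s_set_def B_def)
      \<comment> \<open>Everything below \<open>d0\<close> is a bead, so no element of the
        \<open>s\<close>-set falls below the cut-off \<open>e + s\<close>.\<close>
      moreover have "e \<le> x - int s"
        using x tail[of x] e(1) by (cases "x < d0") (auto simp: s_set_def B_def)
      moreover have "[x - int s = i] (mod int t)" using x shift[of "x - int s"] by auto
      ultimately show "x \<in> (\<lambda>b. b + int s) ` ?X" by (intro image_eqI[of _ _ "x - int s"]) auto
    qed
  qed
  moreover have "?S \<inter> ?Y = {}" by (auto simp: s_set_def B_def)
  moreover have "finite ?X"
    by (rule finite_subset[OF _ finite_beads_ge[OF part, of e]]) (auto simp: B_def)
  moreover have "card ((\<lambda>b. b + int s) ` ?X) = card ?X" by (simp add: card_image)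
  ultimately have "card ?X = card ?S + card ?Y"
    using card_Un_disjoint[of ?S ?Y] finite_Un[of ?S ?Y] finite_imageI[of ?X "\<lambda>b. b + int s"]
    by simp
  then have "int t * int (class_beads_from t B i e) =
      int t * int (card ?S) + int t * int (class_beads_from t B (i + int s) (e + int s))"
    by (simp add: class_beads_from_def algebra_simps)
  then have "a_coord t mu i - e = int t * int (card ?S) + (a_coord t mu (i + int s) - (e + int s))"
    using core_class_beads_from[OF mu(2) t e(2)] core_class_beads_from[OF mu(2) t es]
      d[of e i] d[of "e + int s" "i + int s"] e(1) by simp
  then show ?thesis by (simp add: mu_def)
qed

text \<open>The two coordinates entering \<open>z_coord\<close> belong to classes differing by
  \<open>s\<close>. Being a cardinality, \<open>z_coord\<close> is nonnegative here, so
  \<open>nat\<close> loses nothing later.\<close>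

lemma card_s_set_z_coord:
  assumes "lam \<in> cores s" and "s \<ge> 1" and "t \<ge> 1"
  shows "int (card {x \<in> s_set s lam. [x = int s * (j + 1) + k_shift s t] (mod int t)}) =
    z_coord s t (core_of t lam) j"
proof -
  have eq: "int s * (j + 1) + k_shift s t = int s * j + k_shift s t + int s"
    by (simp add: algebra_simps)
  show ?thesis
    unfolding z_coord_def eq card_s_set_class[OF assms, symmetric] using assms(3) by simp
qed

section \<open>The action of the group on self-conjugate cores\<close>

lemma a_coord_cong_arg: "[i = j] (mod int t) \<Longrightarrow> a_coord t mu i = a_coord t mu j"
  by (simp add: a_coord_def cong_def)

text \<open>The \<open>s\<close>-set of an \<open>s\<close>-core collects the first vacant position
  of each class modulo \<open>s\<close>: membership puts \<open>x\<close> less than \<open>s\<close>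
  above that position, in the same class.\<close>

lemma s_set_iff:
  assumes lam: "lam \<in> cores s" and s: "s \<ge> 1"
  shows "x \<in> s_set s lam \<longleftrightarrow> a_coord s lam x = x"
proof -
  have "[x - int s = x] (mod int s)" by (simp add: cong_def)
  then have "x - int s \<in> beta_set lam \<longleftrightarrow> x - int s < a_coord s lam x"
    by (rule core_beta_set_iff[OF lam s])
  moreover have "x \<in> beta_set lam \<longleftrightarrow> x < a_coord s lam x"
    by (rule core_beta_set_iff[OF lam s cong_refl])
  moreover have "x \<in> s_set s lam \<longleftrightarrow> x - int s \<in> beta_set lam \<and> x \<notin> beta_set lam"
    by (auto simp: s_set_def image_iff intro: bexI[of _ "x - int s"])
  ultimately have iff: "x \<in> s_set s lam \<longleftrightarrow> a_coord s lam x \<le> x \<and> x < a_coord s lam x + int s"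
    by auto
  have part: "is_partition lam" using lam by (simp add: cores_def)
  have "int s dvd x - a_coord s lam x"
    using a_coord_cong[OF part s, of x] by (simp add: cong_iff_dvd_diff dvd_diff_commute)
  then have "a_coord s lam x = x" if "a_coord s lam x \<le> x" "x < a_coord s lam x + int s"
    using that zdvd_imp_le[of "int s" "x - a_coord s lam x"] by linarith
  then show ?thesis using iff s by auto
qed

lemma s_set_representative:
  assumes lam: "lam \<in> cores s" and s: "s \<ge> 1"
  shows "a_coord s lam i \<in> s_set s lam" and "[a_coord s lam i = i] (mod int s)"
    and "x \<in> s_set s lam \<Longrightarrow> [x = i] (mod int s) \<Longrightarrow> a_coord s lam i = x"
proof -
  have part: "is_partition lam" using lam by (simp add: cores_def)
  show cong: "[a_coord s lam i = i] (mod int s)" by (rule a_coord_cong[OF part s])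
  show "a_coord s lam i \<in> s_set s lam"
    unfolding s_set_iff[OF lam s] by (rule a_coord_cong_arg[OF cong])
  show "a_coord s lam i = x" if "x \<in> s_set s lam" "[x = i] (mod int s)"
    using that a_coord_cong_arg[OF that(2), of lam] by (simp add: s_set_iff[OF lam s])
qed

lemma s_set_inject:
  assumes lam: "lam \<in> cores s" and mu: "mu \<in> cores s" and s: "s \<ge> 1"
    and eq: "s_set s lam = s_set s mu"
  shows "lam = mu"
proof -
  have "a_coord s lam i = a_coord s mu i" for i
    using s_set_representative[OF lam s, of i] s_set_representative(3)[OF mu s, of "a_coord s lam i" i]
    by (simp add: eq)
  then have "beta_set lam = beta_set mu"
    using core_beta_set_iff[OF lam s cong_refl] core_beta_set_iff[OF mu s cong_refl] by auto
  then show ?thesis using beta_set_inject lam mu by (simp add: cores_def)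
qed

lemma finite_s_set:
  assumes lam: "lam \<in> cores s" and s: "s \<ge> 1"
  shows "finite (s_set s lam)"
proof (rule finite_subset)
  show "s_set s lam \<subseteq> a_coord s lam ` {0..<int s}"
  proof
    fix x assume "x \<in> s_set s lam"
    then have "a_coord s lam (x mod int s) = x"
      by (intro s_set_representative(3)[OF lam s]) (simp_all add: cong_def)
    moreover have "x mod int s \<in> {0..<int s}" using s by simp
    ultimately show "x \<in> a_coord s lam ` {0..<int s}" by (metis imageI)
  qed
qed simp

lemma self_conjugate_cores_iff:
  assumes "s \<ge> 1"
  shows "lam \<in> self_conjugate_cores s \<longleftrightarrow> is_partition lam \<and>
    (\<forall>b \<in> beta_set lam. b - int s \<in> beta_set lam) \<and>
    (\<forall>x. x \<in> beta_set lam \<longleftrightarrow> - 1 - x \<notin> beta_set lam)"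
  using conjugate_eq_iff[of lam] cores_iff[OF assms, of lam] by (auto simp: self_conjugate_cores_def)

lemma s_set_symmetric:
  assumes "lam \<in> self_conjugate_cores s" and "s \<ge> 1" and "x \<in> s_set s lam"
  shows "int s - 1 - x \<in> s_set s lam"
proof -
  have sym: "y \<in> beta_set lam \<longleftrightarrow> - 1 - y \<notin> beta_set lam" for y
    using assms(1) self_conjugate_cores_iff[OF assms(2)] by blast
  have x: "x - int s \<in> beta_set lam" "x \<notin> beta_set lam" using assms(3) by (auto simp: s_set_def)
  have "- 1 - x \<in> beta_set lam" using x(2) sym[of x] by blast
  moreover have "int s - 1 - x \<notin> beta_set lam" using x(1) sym[of "x - int s"] by (simp add: algebra_simps)
  moreover have "int s - 1 - x = - 1 - x + int s" by simp
  ultimately show ?thesis unfolding s_set_def by (metis DiffI imageI)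
qed

text \<open>
  Symmetry forces the charge condition of \<open>exists_partition\<close>: exactly half of the interval
  from \<open>- M\<close> to \<open>M - 1\<close> lies in \<open>B\<close>.
\<close>

lemma exists_symmetric_partition:
  assumes sym: "\<And>x. x \<in> B \<longleftrightarrow> - 1 - x \<notin> B" and bound: "\<And>b. b \<in> B \<Longrightarrow> b < M" and "0 \<le> M"
  obtains lam where "is_partition lam" "beta_set lam = B"
proof (rule exists_partition)
  show "b \<le> M" if "b \<in> B" for b using bound[OF that] by simp
  show "x \<in> B" if "x < - M" for x using sym[of x] bound[of "- 1 - x"] that by linarith
  let ?X = "{b \<in> B. - M \<le> b}"
  have X: "?X \<subseteq> {- M..<M}" using bound by auto
  then have fin: "finite ?X" by (rule finite_subset) simp
  have "(\<lambda>x. - 1 - x) ` ?X = {- M..<M} - ?X"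
  proof
    show "(\<lambda>x. - 1 - x) ` ?X \<subseteq> {- M..<M} - ?X"
    proof
      fix y assume "y \<in> (\<lambda>x. - 1 - x) ` ?X"
      then obtain x where "y = - 1 - x" "x \<in> B" "- M \<le> x" by auto
      then show "y \<in> {- M..<M} - ?X" using sym[of x] bound[of x] by simp
    qed
    show "{- M..<M} - ?X \<subseteq> (\<lambda>x. - 1 - x) ` ?X"
    proof
      fix y assume "y \<in> {- M..<M} - ?X"
      then show "y \<in> (\<lambda>x. - 1 - x) ` ?X"
        using sym[of "y"] by (intro image_eqI[of _ _ "- 1 - y"]) auto
    qed
  qed
  moreover have "card ((\<lambda>x. - 1 - x) ` ?X) = card ?X" by (rule card_image) (auto intro: inj_onI)
  ultimately have "card ?X = card {- M..<M} - card ?X"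
    using card_Diff_subset[OF fin X] by simp
  moreover have "card ?X \<le> card {- M..<M}" using X by (rule card_mono[rotated]) simp
  ultimately show "int (beads_from B (- M)) = - (- M)"
    using \<open>0 \<le> M\<close> by (simp add: beads_from_def)
qed (rule that)

lemma periodic_shift:
  fixes f :: "int \<Rightarrow> int"
  assumes "\<And>m. f (m + int s) = f m + int s"
  shows "f (m + k * int s) = f m + k * int s"
proof (induction k rule: int_induct[where k = 0])
  case (step1 i)
  then show ?case using assms[of "m + i * int s"] by (simp add: algebra_simps)
next
  case (step2 i)
  then show ?case using assms[of "m + (i - 1) * int s"] by (simp add: algebra_simps)
qed simp

lemma H_groupD:
  assumes "f \<in> carrier (H_group s t)"
  shows "bij f" and "f (m + int s) = f m + int s" and "[f m = m] (mod int t)"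
    and "f (- 1 - m) = - 1 - f m"
  using assms by (auto simp: H_group_def)

text \<open>The displacement \<open>f m - m\<close> is periodic and so bounded, which keeps the
  image of the beta-set bounded above; compatibility with reflection keeps it symmetric, so it is a
  beta-set. Commuting with the shift by \<open>s\<close> preserves the core condition and carries
  \<open>s\<close>-set to \<open>s\<close>-set.\<close>

lemma H_group_image:
  assumes f: "f \<in> carrier (H_group s t)" and lam: "lam \<in> self_conjugate_cores s" and s: "s \<ge> 1"
  shows "\<exists>mu \<in> self_conjugate_cores s. s_set s mu = f ` s_set s lam"
proof -
  define B where "B = beta_set lam"
  have part: "is_partition lam" and down: "\<And>b. b \<in> B \<Longrightarrow> b - int s \<in> B"
    and sym: "\<And>x. x \<in> B \<longleftrightarrow> - 1 - x \<notin> B"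
    using lam self_conjugate_cores_iff[OF s] unfolding B_def by blast+
  note f = H_groupD[OF f]
  have inj: "f x = f y \<longleftrightarrow> x = y" for x y using f(1) by (auto simp: bij_def inj_eq)
  have mem: "f x \<in> f ` B \<longleftrightarrow> x \<in> B" for x using inj by auto
  define M where "M = Max ((\<lambda>i. \<bar>f i - i\<bar>) ` {0..<int s})"
  have close: "\<bar>f m - m\<bar> \<le> M" for m
  proof -
    have "f m - m = f (m mod int s) - m mod int s"
    proof -
      have "f (m mod int s + m div int s * int s) = f (m mod int s) + m div int s * int s"
        by (rule periodic_shift) (rule f(2))
      then show ?thesis using div_mult_mod_eq[of m "int s"] by (simp add: algebra_simps)
    qed
    moreover have "\<bar>f (m mod int s) - m mod int s\<bar> \<le> M"
      unfolding M_def by (rule Max_ge) (use s in auto)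
    ultimately show ?thesis by simp
  qed
  obtain mu where mu: "is_partition mu" "beta_set mu = f ` B"
  proof (rule exists_symmetric_partition)
    show "x \<in> f ` B \<longleftrightarrow> - 1 - x \<notin> f ` B" for x
    proof -
      obtain m where m: "x = f m" using f(1) by (metis bij_pointE)
      show ?thesis using sym[of m] mem[of m] mem[of "- 1 - m"] unfolding m f(4) by blast
    qed
    show "b < int (lam 0) + M" if "b \<in> f ` B" for b
    proof -
      obtain c where "b = f c" "c \<in> B" using \<open>b \<in> f ` B\<close> by auto
      then show ?thesis using close[of c] beta_set_bounded[OF part, of c] by (simp add: B_def)
    qed
    show "0 \<le> int (lam 0) + M" using close[of 0] by simp
  qed
  have fs: "f b - int s = f (b - int s)" for b using f(2)[of "b - int s"] by simp
  have "s_set s mu = f ` s_set s lam"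
  proof -
    have "(\<lambda>b. b + int s) ` f ` B = f ` (\<lambda>b. b + int s) ` B"
      by (simp add: image_image f(2))
    moreover have "inj f" using f(1) by (simp add: bij_def)
    ultimately show ?thesis by (simp add: s_set_def mu(2) B_def[symmetric] image_set_diff)
  qed
  moreover have "mu \<in> self_conjugate_cores s"
    unfolding self_conjugate_cores_iff[OF s] mu(2)
  proof (intro conjI ballI allI)
    show "b - int s \<in> f ` B" if "b \<in> f ` B" for b using that down by (auto simp: fs)
    show "x \<in> f ` B \<longleftrightarrow> - 1 - x \<notin> f ` B" for x
    proof -
      obtain m where m: "x = f m" using f(1) by (metis bij_pointE)
      show ?thesis using sym[of m] mem[of m] mem[of "- 1 - m"] unfolding m f(4) by blast
    qed
  qed (rule mu(1))
  ultimately show ?thesis by blast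
qed

text \<open>The image core exists by \<open>H_group_image\<close> and is unique because an
  \<open>s\<close>-core is determined by its \<open>s\<close>-set; both are needed to evaluate the
  definite description in \<open>H_action\<close>.\<close>

lemma stabilizer_H_action:
  assumes lam: "lam \<in> self_conjugate_cores s" and s: "s \<ge> 1"
  shows "stabilizer (H_group s t) (H_action s) lam =
    {f \<in> carrier (H_group s t). f ` s_set s lam = s_set s lam}"
proof -
  have "H_action s f lam = lam \<longleftrightarrow> f ` s_set s lam = s_set s lam"
    if f: "f \<in> carrier (H_group s t)" for f
  proof -
    obtain mu where mu: "mu \<in> self_conjugate_cores s" "s_set s mu = f ` s_set s lam"
      using H_group_image[OF f lam s] by blast
    have "H_action s f lam = mu"
      unfolding H_action_def
    proof (rule the_equality)
      show "nu = mu" if "nu \<in> self_conjugate_cores s \<and> s_set s nu = f ` s_set s lam" for nu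
        using that mu s_set_inject[of nu s mu] s by (simp add: self_conjugate_cores_def)
    qed (use mu in simp)
    moreover have "mu = lam \<longleftrightarrow> s_set s mu = s_set s lam"
      using mu(1) lam s_set_inject[of mu s lam] s by (auto simp: self_conjugate_cores_def)
    ultimately show ?thesis using mu(2) by simp
  qed
  then show ?thesis by (auto simp: stabilizer_def)
qed

text \<open>The sum condition appears as vanishing total displacement, a form that can be reindexed
  from one period to the \<open>s\<close>-set.\<close>

lemma H_groupI:
  assumes s: "s \<ge> 1"
    and "bij f" and period: "\<And>m. f (m + int s) = f m + int s"
    and "\<And>m. [f m = m] (mod int t)" and "\<And>m. f (- 1 - m) = - 1 - f m"
    and "(\<Sum>i\<in>{0..<int s}. f i - i) = 0"
  shows "f \<in> carrier (H_group s t)"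
proof -
  have "(\<Sum>i\<in>{0..<int s}. i) = int (s choose 2)"
  proof -
    have "(\<Sum>i\<in>{0..<int s}. i) = (\<Sum>i\<in>{0..<s}. int i)"
      by (simp add: image_int_atLeastLessThan[of 0 s, simplified, symmetric] sum.reindex)
    also have "\<dots> = int (\<Sum>i\<in>{0..<s}. i)" by simp
    also have "(\<Sum>i\<in>{0..<s}. i) = s choose 2"
      by (simp add: choose_two Sum_Ico_nat[of 0 s, simplified])
    finally show ?thesis .
  qed
  then show ?thesis using assms by (simp add: H_group_def sum_subtractf)
qed

text \<open>With \<open>r m\<close> the element of \<open>S\<close> congruent to \<open>m\<close>
  modulo \<open>s\<close>, periodicity forces \<open>f m = f (r m) + (m - r m)\<close>. So
  restriction to \<open>S\<close> is injective, and the same formula extends a permutation of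
  \<open>S\<close>.\<close>

lemma card_stabilizer:
  assumes lam: "lam \<in> self_conjugate_cores s" and s: "s \<ge> 1"
  shows "card (stabilizer (H_group s t) (H_action s) lam) =
    card {p. p permutes s_set s lam \<and> (\<forall>x \<in> s_set s lam.
      [p x = x] (mod int t) \<and> p (int s - 1 - x) = int s - 1 - p x)}"
proof -
  define S where "S = s_set s lam"
  define r where "r = a_coord s lam"
  have core: "lam \<in> cores s" using lam by (simp add: self_conjugate_cores_def)
  have finS: "finite S" using finite_s_set[OF core s] by (simp add: S_def)
  have r_S: "r m \<in> S" and r_cong: "[r m = m] (mod int s)"
    and r_eq: "x \<in> S \<Longrightarrow> [x = m] (mod int s) \<Longrightarrow> r m = x" for m x
    using s_set_representative[OF core s] by (auto simp: S_def r_def)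
  have S_sym: "int s - 1 - x \<in> S" if "x \<in> S" for x
    using s_set_symmetric[OF lam s] that by (simp add: S_def)
  have r_id: "r x = x" if "x \<in> S" for x by (rule r_eq[OF that cong_refl])
  have r_period: "r (m + int s) = r m" for m
    by (simp add: r_def a_coord_cong_arg[of "m + int s" m s] cong_def)
  have r_sym: "r (- 1 - m) = int s - 1 - r m" for m
  proof (rule r_eq[OF S_sym[OF r_S]])
    have "[int s - (1 + r m) = 0 - (1 + m)] (mod int s)"
      by (intro cong_diff cong_add cong_refl r_cong) (simp add: cong_0_iff)
    then show "[int s - 1 - r m = - 1 - m] (mod int s)" by (simp add: algebra_simps)
  qed
  let ?H = "{f \<in> carrier (H_group s t). f ` S = S}"
  let ?P = "{p. p permutes S \<and> (\<forall>x\<in>S. [p x = x] (mod int t) \<and> p (int s - 1 - x) = int s - 1 - p x)}"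
  define restr where "restr f x = (if x \<in> S then f x else x)" for f :: "int \<Rightarrow> int" and x
  define ext where "ext p m = p (r m) + (m - r m)" for p :: "int \<Rightarrow> int" and m
  have "bij_betw restr ?H ?P"
  proof (rule bij_betw_byWitness[where f' = ext])
    show "\<forall>f\<in>?H. ext (restr f) = f"
    proof
      fix f assume "f \<in> ?H"
      then have period: "f (m + int s) = f m + int s" for m using H_groupD(2) by blast
      show "ext (restr f) = f"
      proof
        fix m
        obtain k where k: "m = r m + int s * k" using r_cong[of m] by (metis cong_iff_lin)
        have "f m = f (r m + k * int s)" using k by (metis mult.commute)
        also have "\<dots> = f (r m) + k * int s" by (rule periodic_shift) (rule period)
        also have "\<dots> = f (r m) + (m - r m)" using k by (simp add: mult.commute)
        finally show "ext (restr f) m = f m" using r_S by (simp add: ext_def restr_def)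
      qed
    qed
    show "\<forall>p\<in>?P. restr (ext p) = p"
      by (auto simp: restr_def ext_def r_id permutes_not_in)
    show "restr ` ?H \<subseteq> ?P"
    proof clarify
      fix f assume f: "f \<in> carrier (H_group s t)" and fS: "f ` S = S"
      note fD = H_groupD[OF f]
      have "bij_betw (restr f) S S"
        unfolding bij_betw_def
      proof
        show "inj_on (restr f) S" using fD(1) by (auto simp: inj_on_def restr_def bij_def)
        show "restr f ` S = S" using fS by (simp add: restr_def)
      qed
      then have "restr f permutes S" by (rule bij_imp_permutes) (simp add: restr_def)
      \<comment> \<open>The reflection \<open>- 1 - x\<close> followed by the shift by
        \<open>s\<close> is the involution that preserves \<open>S\<close>.\<close>
      moreover have "f (int s - 1 - x) = int s - 1 - f x" for x
        using fD(2)[of "- 1 - x"] fD(4)[of x] by (simp add: algebra_simps)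
      ultimately show "restr f permutes S \<and> (\<forall>x\<in>S. [restr f x = x] (mod int t) \<and>
          restr f (int s - 1 - x) = int s - 1 - restr f x)"
        using fD(3) S_sym by (simp add: restr_def)
    qed
    show "ext ` ?P \<subseteq> ?H"
    proof clarify
      fix p assume p: "p permutes S"
        and p': "\<forall>x\<in>S. [p x = x] (mod int t) \<and> p (int s - 1 - x) = int s - 1 - p x"
      have pS: "p (r m) \<in> S" for m using p r_S by (simp add: permutes_in_image)
      have ext_S: "ext p x = p x" if "x \<in> S" for x using r_id[OF that] by (simp add: ext_def)
      have r_ext: "r (ext p m) = p (r m)" for m
      proof (rule r_eq[OF pS])
        have "[p (r m) + (r m - r m) = p (r m) + (m - r m)] (mod int s)"
          by (intro cong_add cong_diff cong_refl r_cong)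
        then show "[p (r m) = ext p m] (mod int s)" by (simp add: ext_def)
      qed
      have "bij (ext p)"
      proof (rule bijI)
        show "inj (ext p)"
        proof (rule injI)
          fix m n assume eq: "ext p m = ext p n"
          then have "p (r m) = p (r n)" using r_ext by metis
          then have "r m = r n" using permutes_inj[OF p] by (simp add: inj_eq)
          then show "m = n" using eq by (simp add: ext_def)
        qed
        show "surj (ext p)"
        proof (rule surjI)
          fix y
          obtain x where x: "x \<in> S" "r y = p x"
            using r_S[of y] permutes_image[OF p] by (metis imageE)
          \<comment> \<open>The preimage of \<open>y\<close> is the preimage of its representative
            \<open>r y\<close>, moved by the multiple of \<open>s\<close> that separates
            \<open>y\<close> from \<open>r y\<close>.\<close>
          have "r (x + (y - r y)) = x"
          proof (rule r_eq[OF x(1)])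
            have "[x + (r y - r y) = x + (y - r y)] (mod int s)"
              by (intro cong_add cong_diff cong_refl r_cong)
            then show "[x = x + (y - r y)] (mod int s)" by simp
          qed
          then have "ext p (x + (y - r y)) = y" using x by (simp add: ext_def)
          then show "ext p (SOME m. ext p m = y) = y" by (rule someI)
        qed
      qed
      moreover have "ext p (m + int s) = ext p m + int s" for m
        by (simp add: ext_def r_period)
      moreover have "[ext p m = m] (mod int t)" for m
      proof -
        have "[p (r m) + (m - r m) = r m + (m - r m)] (mod int t)"
          using p' r_S by (intro cong_add cong_refl) blast
        then show ?thesis by (simp add: ext_def)
      qed
      moreover have "ext p (- 1 - m) = - 1 - ext p m" for m
        using p' r_S[of m] by (simp add: ext_def r_sym)
      \<comment> \<open>The displacement of \<open>ext p\<close> at \<open>i\<close> is that of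
        \<open>p\<close> at \<open>r i\<close>. Over one period \<open>r i\<close> runs once through
        \<open>S\<close>, where a permutation has total displacement zero.\<close>
      moreover have "(\<Sum>i\<in>{0..<int s}. ext p i - i) = 0"
      proof -
        have "bij_betw r {0..<int s} S"
        proof (rule bij_betw_byWitness[where f' = "\<lambda>x. x mod int s"])
          show "\<forall>i\<in>{0..<int s}. r i mod int s = i"
            using r_cong by (auto simp: cong_def)
          show "\<forall>x\<in>S. r (x mod int s) = x"
            by (auto intro!: r_eq simp: cong_def)
          show "r ` {0..<int s} \<subseteq> S" using r_S by auto
          show "(\<lambda>x. x mod int s) ` S \<subseteq> {0..<int s}" using s by auto
        qed
        then have "(\<Sum>i\<in>{0..<int s}. p (r i) - r i) = (\<Sum>x\<in>S. p x - x)"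
          by (rule sum.reindex_bij_betw)
        also have "\<dots> = 0"
          using sum.permute[OF p, of "\<lambda>x. x"] by (simp add: sum_subtractf comp_def)
        finally show ?thesis by (simp add: ext_def)
      qed
      ultimately have "ext p \<in> carrier (H_group s t)" using s by (intro H_groupI)
      moreover have "ext p ` S = S" using ext_S permutes_image[OF p] by (simp cong: image_cong)
      ultimately show "ext p \<in> carrier (H_group s t) \<and> ext p ` S = S" by simp
    qed
  qed
  then show ?thesis
    unfolding stabilizer_H_action[OF lam s] S_def by (rule bij_betw_same_card)
qed

section \<open>Counting permutations\<close>

text \<open>A permutation of \<open>insert a A\<close> factors uniquely as a permutation of
  \<open>A\<close> followed by the transposition of \<open>a\<close> with its image
  \<open>b\<close>; preserving classes only restricts \<open>b\<close> to the class of
  \<open>a\<close>.\<close>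

lemma card_class_permutations:
  assumes "finite A"
  shows "card {p. p permutes A \<and> (\<forall>x\<in>A. cl (p x) = cl x)} =
    (\<Prod>j\<in>cl ` A. fact (card {x \<in> A. cl x = j}))"
  using assms
proof (induction A rule: finite_induct)
  case empty
  have "{p. p permutes ({} :: 'a set) \<and> (\<forall>x\<in>{}. cl (p x) = cl x)} = {id}" by auto
  then show ?case by simp
next
  case (insert a A)
  let ?P = "\<lambda>A. {p. p permutes A \<and> (\<forall>x\<in>A. cl (p x) = cl x)}"
  let ?N = "\<lambda>A j. card {x \<in> A. cl x = j}"
  let ?C = "{b \<in> insert a A. cl b = cl a}"
  let ?h = "\<lambda>(b, p). transpose a b \<circ> p"
  have eq: "?P (insert a A) = ?h ` (?C \<times> ?P A)"
  proof
    show "?h ` (?C \<times> ?P A) \<subseteq> ?P (insert a A)"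
    proof
      fix q assume "q \<in> ?h ` (?C \<times> ?P A)"
      then obtain b p where b: "b \<in> insert a A" "cl b = cl a"
        and p: "p permutes A" "\<forall>x\<in>A. cl (p x) = cl x" and q: "q = transpose a b \<circ> p" by auto
      have "transpose a b \<circ> p permutes insert a A"
        using b(1) p(1) permutes_insert[of a A] by auto
      moreover have "cl (transpose a b y) = cl y" for y
        using b(2) by (auto simp: transpose_def)
      moreover have "p a = a" using p(1) insert.hyps by (simp add: permutes_not_in)
      ultimately show "q \<in> ?P (insert a A)" using p(2) q b(2) by simp
    qed
    show "?P (insert a A) \<subseteq> ?h ` (?C \<times> ?P A)"
    proof
      fix q assume "q \<in> ?P (insert a A)"
      then have q: "q permutes insert a A" "\<forall>x\<in>insert a A. cl (q x) = cl x" by auto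
      then have "q \<in> ?h ` {(b, p). b \<in> insert a A \<and> p \<in> {p. p permutes A}}"
        using permutes_insert[of a A] by auto
      then obtain b p where bp: "q = transpose a b \<circ> p" "b \<in> insert a A" "p permutes A" by auto
      have "p a = a" using bp(3) insert.hyps by (simp add: permutes_not_in)
      then have "q a = b" using bp(1) by simp
      then have b: "cl b = cl a" using q(2) by auto
      have "cl (transpose a b y) = cl y" for y
        using b by (auto simp: transpose_def)
      then have "\<forall>x\<in>A. cl (p x) = cl x" using q(2) bp(1) by simp
      then show "q \<in> ?h ` (?C \<times> ?P A)" using bp b by (intro image_eqI[of _ _ "(b, p)"]) auto
    qed
  qed
  have inj: "inj_on ?h (?C \<times> ?P A)"
  proof (rule inj_onI, clarify)
    fix b p c q
    assume p: "p permutes A" and q: "q permutes A"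
      and h: "transpose a b \<circ> p = transpose a c \<circ> q"
    have "p a = a" "q a = a" using p q insert.hyps by (simp_all add: permutes_not_in)
    then have "b = c" using fun_cong[OF h, of a] by simp
    moreover from this have "p = q" using h by (metis comp_assoc id_comp transpose_comp_involutory)
    ultimately show "b = c \<and> p = q" by simp
  qed
  have C: "card ?C = Suc (?N A (cl a))"
  proof -
    have "?C = insert a {x \<in> A. cl x = cl a}" by auto
    then show ?thesis using insert.hyps by simp
  qed
  have "card (?P (insert a A)) = card ?C * card (?P A)"
    unfolding eq card_image[OF inj] by (rule card_cartesian_product)
  also have "\<dots> = Suc (?N A (cl a)) * (\<Prod>j\<in>cl ` A. fact (?N A j))"
    using insert.IH C by simp
  \<comment> \<open>If \<open>a\<close> opens a new class, the additional factor is
    \<open>fact 0\<close>.\<close>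
  also have "(\<Prod>j\<in>cl ` A. fact (?N A j)) = (\<Prod>j\<in>cl ` insert a A. fact (?N A j) :: nat)"
  proof (rule prod.mono_neutral_left)
    show "\<forall>j\<in>cl ` insert a A - cl ` A. fact (?N A j) = (1 :: nat)"
    proof
      fix j assume "j \<in> cl ` insert a A - cl ` A"
      then have empty: "{x \<in> A. cl x = j} = {}" by auto
      show "fact (?N A j) = (1 :: nat)" unfolding empty by simp
    qed
  qed (use insert.hyps in auto)
  also have "\<dots> = fact (?N A (cl a)) * (\<Prod>j\<in>cl ` insert a A - {cl a}. fact (?N A j))"
    by (rule prod.remove) (use insert.hyps in auto)
  also have "(\<Prod>j\<in>cl ` insert a A - {cl a}. fact (?N A j)) =
      (\<Prod>j\<in>cl ` insert a A - {cl a}. fact (?N (insert a A) j) :: nat)"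
  proof (rule prod.cong)
    fix j assume "j \<in> cl ` insert a A - {cl a}"
    then have same: "{x \<in> insert a A. cl x = j} = {x \<in> A. cl x = j}" by auto
    show "fact (?N A j) = (fact (?N (insert a A) j) :: nat)" unfolding same ..
  qed simp
  also have "Suc (?N A (cl a)) * (fact (?N A (cl a)) * \<dots>) =
      fact (?N (insert a A) (cl a)) * (\<Prod>j\<in>cl ` insert a A - {cl a}. fact (?N (insert a A) j))"
    unfolding C by (simp add: algebra_simps)
  also have "\<dots> = (\<Prod>j\<in>cl ` insert a A. fact (?N (insert a A) j))"
    by (rule prod.remove[symmetric]) (use insert.hyps in auto)
  finally show ?case .
qed

text \<open>
  A class-preserving permutation commuting with the involution \<open>sg\<close> is determined by its values
  on the half \<open>A\<close>: it acts there as a class-preserving permutation of \<open>A\<close>, followed by \<open>sg\<close> on a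
  set of points whose class is stable under \<open>sg\<close>.
\<close>

lemma card_involution_permutations:
  fixes sg :: "'a \<Rightarrow> 'a" and cl :: "'a \<Rightarrow> 'b"
  assumes fin: "finite S" and A: "A \<subseteq> S"
    and inv_S: "\<And>x. x \<in> S \<Longrightarrow> sg x \<in> S" and inv_inv: "\<And>x. x \<in> S \<Longrightarrow> sg (sg x) = x"
    and half: "\<And>x. x \<in> S \<Longrightarrow> sg x \<noteq> x \<Longrightarrow> sg x \<in> A \<longleftrightarrow> x \<notin> A"
    and fixed: "\<And>x. x \<in> A \<Longrightarrow> sg x \<noteq> x"
    and fixed_unique: "\<And>x y. x \<in> S \<Longrightarrow> y \<in> S \<Longrightarrow> sg x = x \<Longrightarrow> sg y = y \<Longrightarrow> x = y"
    and cl_inv: "\<And>x y. x \<in> S \<Longrightarrow> y \<in> S \<Longrightarrow> cl x = cl y \<Longrightarrow> cl (sg x) = cl (sg y)"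
    and cl_half: "\<And>x y. x \<in> A \<Longrightarrow> y \<in> A \<Longrightarrow> cl (sg x) = cl y \<Longrightarrow> cl x = cl y"
  shows "card {p. p permutes S \<and> (\<forall>x\<in>S. cl (p x) = cl x \<and> p (sg x) = sg (p x))} =
    2 ^ card {x \<in> A. cl (sg x) = cl x} * card {p. p permutes A \<and> (\<forall>x\<in>A. cl (p x) = cl x)}"
proof -
  let ?P = "{p. p permutes S \<and> (\<forall>x\<in>S. cl (p x) = cl x \<and> p (sg x) = sg (p x))}"
  let ?Q = "{p. p permutes A \<and> (\<forall>x\<in>A. cl (p x) = cl x)}"
  let ?D = "{x \<in> A. cl (sg x) = cl x}"
  \<comment> \<open>\<open>X\<close> is the set of points at which \<open>sg\<close> is applied
    after \<open>q\<close>. \<open>F\<close> extends the result from \<open>A\<close> to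
    \<open>S\<close> by commuting with \<open>sg\<close>, with fixed points left in place.\<close>
  define v where "v X q x = (if x \<in> X then sg (q x) else q x)" for X and q :: "'a \<Rightarrow> 'a" and x
  define F where "F = (\<lambda>(X, q) x. if x \<in> A then v X q x
    else if x \<in> S \<and> sg x \<in> A then sg (v X q (sg x)) else x)"
  \<comment> \<open>\<open>rep\<close> chooses the member in \<open>A\<close> of a two-element
    orbit, so \<open>res p\<close> is the permutation of orbits induced by \<open>p\<close>; the set
    in \<open>G\<close> records where \<open>p\<close> leaves the half.\<close>
  define rep where "rep x = (if x \<in> A then x else sg x)" for x
  define res where "res p x = (if x \<in> A then rep (p x) else x)" for p :: "'a \<Rightarrow> 'a" and x
  define G where "G p = ({x \<in> A. p x \<notin> A}, res p)" for p :: "'a \<Rightarrow> 'a"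
  have finA: "finite A" using fin A by (rule finite_subset[rotated])
  have AS: "x \<in> S" if "x \<in> A" for x using that A by auto
  have inv_A: "sg x \<notin> A" if "x \<in> A" for x using half[of x] fixed[OF that] AS[OF that] that by auto
  have inv_inj: "sg x = sg y \<longleftrightarrow> x = y" if "x \<in> S" "y \<in> S" for x y
    using that inv_inv by metis
  have F_in: "F (X, q) \<in> ?P" and G_F: "G (F (X, q)) = (X, q)"
    if X: "X \<subseteq> ?D" and q: "q permutes A" "\<forall>x\<in>A. cl (q x) = cl x" for X q
  proof -
    let ?p = "F (X, q)" and ?v = "v X q"
    have qA: "q x \<in> A" if "x \<in> A" for x using q(1) that by (simp add: permutes_in_image)
    have v_S: "?v x \<in> S" and v_rep: "rep (?v x) = q x" and v_A: "?v x \<in> A \<longleftrightarrow> x \<notin> X"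
      and v_fixed: "sg (?v x) \<noteq> ?v x" and v_cl: "cl (?v x) = cl x" if x: "x \<in> A" for x
    proof -
      note qx = qA[OF x] AS[OF qA[OF x]]
      show "?v x \<in> S" using qx inv_S by (simp add: v_def)
      show "rep (?v x) = q x" using qx inv_A inv_inv by (simp add: v_def rep_def)
      show "?v x \<in> A \<longleftrightarrow> x \<notin> X" using qx inv_A by (simp add: v_def)
      show "sg (?v x) \<noteq> ?v x"
        using fixed[OF qx(1)] fixed[OF qx(1), symmetric] inv_inv[OF qx(2)] by (simp add: v_def)
      show "cl (?v x) = cl x"
        using X q(2) cl_inv[of "q x" x] AS[OF x] qx x by (auto simp: v_def)
    qed
    have p_A: "?p x = ?v x" if "x \<in> A" for x using that by (simp add: F_def)
    have p_inv: "?p (sg x) = sg (?v x)" if "x \<in> A" for x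
      using that inv_A inv_S AS inv_inv by (simp add: F_def)
    have p_fixed: "?p x = x" if "sg x = x" for x using that fixed by (auto simp: F_def)
    have cases: "x \<in> A \<or> sg x = x \<or> (\<exists>a\<in>A. x = sg a)" if "x \<in> S" for x
      using half[OF that] inv_inv[OF that] by metis
    have p_S: "?p x \<in> S" if "x \<in> S" for x
      using cases[OF that] that p_A p_inv p_fixed v_S inv_S by auto
    have p_comm: "?p (sg x) = sg (?p x)" if "x \<in> S" for x
      using cases[OF that] that p_A p_inv p_fixed v_S inv_inv AS by auto
    have p_cl: "cl (?p x) = cl x" if "x \<in> S" for x
      using cases[OF that]
    proof (elim disjE bexE)
      fix a assume a: "a \<in> A" "x = sg a"
      then show ?thesis using p_inv[of a] cl_inv[of "?v a" a] v_cl[of a] v_S[of a] AS[of a] by simp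
    qed (use p_A v_cl p_fixed in auto)
    have p_rep: "rep (?p x) = q (rep x)" and p_moved: "sg (?p x) \<noteq> ?p x"
      if x: "x \<in> S" "sg x \<noteq> x" for x
    proof -
      have "rep (?p x) = q (rep x) \<and> sg (?p x) \<noteq> ?p x"
        using cases[OF x(1)]
      proof (elim disjE bexE)
        assume "x \<in> A"
        then show ?thesis using p_A v_rep v_fixed by (simp add: rep_def)
      next
        fix a assume a: "a \<in> A" "x = sg a"
        have "rep (sg (?v a)) = rep (?v a)"
          using half[of "?v a"] v_S[OF a(1)] v_fixed[OF a(1)] inv_inv by (auto simp: rep_def)
        then show ?thesis
          using a p_inv[of a] v_rep[of a] v_fixed[of a] inv_inv[of "?v a"] v_S[of a] inv_A[of a]
            inv_inv[of a] AS[of a] by (auto simp: rep_def)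
      qed (use x in simp)
      then show "rep (?p x) = q (rep x)" "sg (?p x) \<noteq> ?p x" by auto
    qed
    have "inj_on ?p S"
    proof (rule inj_onI)
      fix x y assume x: "x \<in> S" and y: "y \<in> S" and eq: "?p x = ?p y"
      show "x = y"
      proof (cases "sg x = x \<or> sg y = y")
        case True
        then have "sg (?p x) = ?p x" using p_fixed eq by metis
        then have "sg x = x" "sg y = y" using p_moved x y eq by metis+
        then show ?thesis using fixed_unique x y by blast
      next
        case False
        then have "q (rep x) = q (rep y)" using p_rep[OF x] p_rep[OF y] eq by simp
        then have "rep x = rep y" using permutes_inj[OF q(1)] by (simp add: inj_eq)
        then have "x = y \<or> x = sg y"
          using inv_inj x y inv_inv by (auto simp: rep_def split: if_splits)
        \<comment> \<open>Otherwise the common value of \<open>?p\<close> at \<open>x\<close> and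
          \<open>y\<close> would be fixed by \<open>sg\<close>, although \<open>y\<close> is
          not.\<close>
        moreover have "x \<noteq> sg y" using p_comm[OF y] p_moved[OF y] False eq by metis
        ultimately show ?thesis by simp
      qed
    qed
    then have "bij_betw ?p S S"
      using fin p_S by (simp add: bij_betw_def endo_inj_surj image_subsetI)
    then have "?p permutes S"
      by (rule bij_imp_permutes) (use AS in \<open>auto simp: F_def\<close>)
    then show "?p \<in> ?P" using p_cl p_comm by simp
    have "{x \<in> A. ?p x \<notin> A} = X" using X p_A v_A by auto
    moreover have "res ?p = q"
      using p_A v_rep q(1) by (auto simp: res_def permutes_not_in)
    ultimately show "G ?p = (X, q)" by (simp add: G_def)
  qed
  have G_in: "{x \<in> A. p x \<notin> A} \<subseteq> ?D" "res p permutes A" "\<forall>x\<in>A. cl (res p x) = cl x"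
    and F_G: "F (G p) = p"
    if p: "p permutes S" "\<And>x. x \<in> S \<Longrightarrow> cl (p x) = cl x" "\<And>x. x \<in> S \<Longrightarrow> p (sg x) = sg (p x)" for p
  proof -
    have pS: "p x \<in> S" if "x \<in> S" for x using p(1) that by (simp add: permutes_in_image)
    have moved: "sg (p x) \<noteq> p x" if "x \<in> A" for x
    proof
      assume "sg (p x) = p x"
      then have "p (sg x) = p x" unfolding p(3)[OF AS[OF that]] .
      then have "sg x = x" using permutes_inj[OF p(1)] by (simp add: inj_eq)
      then show False using fixed[OF that] by contradiction
    qed
    have other: "sg (p x) \<in> A" if "x \<in> A" "p x \<notin> A" for x
      using half[OF pS[OF AS[OF that(1)]] moved[OF that(1)]] that(2) by blast
    have rep_A: "rep (p x) \<in> A" if "x \<in> A" for x using other that by (simp add: rep_def)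
    \<comment> \<open>When \<open>p x\<close> leaves the half, \<open>sg (p x)\<close> is a point of
      \<open>A\<close> in the class of \<open>sg x\<close>; \<open>cl_half\<close> then identifies
      that class with the class of \<open>x\<close>. Thus swaps occur only in self-paired
      classes.\<close>
    have swap: "cl (sg x) = cl x \<and> cl (sg (p x)) = cl x" if x: "x \<in> A" "p x \<notin> A" for x
    proof -
      have "cl (sg (p x)) = cl (sg x)"
        by (rule cl_inv[OF pS[OF AS[OF x(1)]] AS[OF x(1)] p(2)[OF AS[OF x(1)]]])
      then show ?thesis using cl_half[OF x(1) other[OF x]] by metis
    qed
    then show "{x \<in> A. p x \<notin> A} \<subseteq> ?D" by auto
    show "\<forall>x\<in>A. cl (res p x) = cl x"
    proof
      fix x assume "x \<in> A"
      then show "cl (res p x) = cl x"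
        using swap[of x] p(2)[OF AS[of x]] by (auto simp: res_def rep_def)
    qed
    have "inj_on (res p) A"
    proof (rule inj_onI)
      fix x y assume x: "x \<in> A" and y: "y \<in> A" and "res p x = res p y"
      then have "rep (p x) = rep (p y)" by (simp add: res_def)
      then have "p x = p y \<or> p x = sg (p y)"
        using inv_inj[OF pS[OF AS[OF x]] pS[OF AS[OF y]]] inv_inv[OF pS[OF AS[OF x]]]
        by (auto simp: rep_def split: if_splits)
      then have "x = y \<or> x = sg y"
        using p(3)[OF AS[OF y]] permutes_inj[OF p(1)] by (metis injD)
      then show "x = y" using inv_A[OF y] x by auto
    qed
    moreover have "res p ` A \<subseteq> A" using rep_A by (auto simp: res_def)
    ultimately have "bij_betw (res p) A A"
      using finA by (simp add: bij_betw_def endo_inj_surj)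
    then show "res p permutes A" by (rule bij_imp_permutes) (simp add: res_def)
    show "F (G p) = p"
    proof
      fix x
      have v: "v {x \<in> A. p x \<notin> A} (res p) a = p a" if "a \<in> A" for a
        using that inv_inv[OF pS[OF AS[OF that]]] by (simp add: v_def res_def rep_def)
      consider "x \<in> A" | "x \<notin> A" "x \<in> S" "sg x \<in> A" | "x \<notin> A" "x \<in> S" "sg x = x" | "x \<notin> S"
        using half[of x] by blast
      then show "F (G p) x = p x"
      proof cases
        case 1
        then show ?thesis using v by (simp add: F_def G_def)
      next
        case 2
        then have "sg (p (sg x)) = p x" using p(3)[of x] inv_inv pS by simp
        then show ?thesis using 2 v by (simp add: F_def G_def)
      next
        case 3
        then have "sg (p x) = p x" using p(3)[of x] by simp
        \<comment> \<open>\<open>p\<close> sends a fixed point of \<open>sg\<close> to a fixed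
          point, and there is at most one.\<close>
        then have "p x = x" using 3 fixed_unique pS by blast
        then show ?thesis using 3 by (simp add: F_def G_def)
      next
        case 4
        then show ?thesis using p(1) AS by (auto simp: F_def G_def permutes_not_in)
      qed
    qed
  qed
  have "bij_betw F (Pow ?D \<times> ?Q) ?P"
  proof (rule bij_betw_byWitness[where f' = G])
    show "\<forall>z\<in>Pow ?D \<times> ?Q. G (F z) = z" using G_F by auto
    show "\<forall>p\<in>?P. F (G p) = p" using F_G by auto
    show "F ` (Pow ?D \<times> ?Q) \<subseteq> ?P" using F_in by blast
    show "G ` ?P \<subseteq> Pow ?D \<times> ?Q"
    proof
      fix y assume "y \<in> G ` ?P"
      then obtain p where "p \<in> ?P" and y: "y = G p" by blast
      then show "y \<in> Pow ?D \<times> ?Q" using G_in[of p] unfolding y G_def by blast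
    qed
  qed
  then have "card ?P = card (Pow ?D \<times> ?Q)" by (rule bij_betw_same_card[symmetric])
  then show ?thesis using finA by (simp add: card_cartesian_product card_Pow)
qed

section \<open>The order of the stabilizer\<close>

text \<open>Coprime \<open>s\<close> and \<open>t\<close> are not both even, so one of the two
  factors is even and the halving is exact.\<close>

lemma two_k_shift:
  assumes "coprime s t"
  shows "2 * k_shift s t = (int s + 1) * (int t - 1)"
proof -
  have "odd s \<or> odd t" using assms coprime_common_divisor[of s t 2] by auto
  then have "even ((int s + 1) * (int t - 1))" by auto
  then show ?thesis by (simp add: k_shift_def)
qed

text \<open>The index is found by inverting \<open>s\<close> modulo \<open>t\<close>. The class of
  index \<open>j\<close> uses \<open>j + 1\<close> because that is the class counted by
  \<open>z_coord\<close> at \<open>j\<close>; with indices in \<open>0..<t\<close>, negation reads 0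
  to 0 and \<open>j\<close> to \<open>t - j\<close>.\<close>

lemma exists_class_index:
  assumes "coprime s t" and t: "t \<ge> 1"
  shows "\<exists>cl :: int \<Rightarrow> nat. (\<forall>x. cl x < t) \<and> (\<forall>x y. cl x = cl y \<longleftrightarrow> [x = y] (mod int t)) \<and>
    (\<forall>x. \<forall>j<t. cl x = j \<longleftrightarrow> [x = int s * (int j + 1) + k_shift s t] (mod int t)) \<and>
    (\<forall>x. cl (int s - 1 - x) = (if cl x = 0 then 0 else t - cl x))"
proof -
  define k where "k = k_shift s t"
  obtain v where v: "[int s * v = 1] (mod int t)"
    using cong_solve_coprime_int[of "int s" "int t"] assms(1) by auto
  define cl where "cl x = nat ((v * (x - k) - 1) mod int t)" for x
  have cl_less: "cl x < t" for x using t by (simp add: cl_def nat_less_iff)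
  have int_cl: "int (cl x) = (v * (x - k) - 1) mod int t" for x using t by (simp add: cl_def)
  have iff: "cl x = j \<longleftrightarrow> [x = int s * (int j + 1) + k] (mod int t)" if "j < t" for x j
  proof -
    have "cl x = j \<longleftrightarrow> int (cl x) = int j mod int t" using that by simp
    also have "\<dots> \<longleftrightarrow> [v * (x - k) - 1 = int j] (mod int t)" unfolding int_cl cong_def ..
    also have "\<dots> \<longleftrightarrow> [x = int s * (int j + 1) + k] (mod int t)"
    proof
      assume "[v * (x - k) - 1 = int j] (mod int t)"
      then have "[v * (x - k) - 1 + 1 = int j + 1] (mod int t)" by (rule cong_add) simp
      then have "[int s * (v * (x - k)) = int s * (int j + 1)] (mod int t)"
        by (intro cong_mult cong_refl) simp
      moreover have "[int s * v * (x - k) = 1 * (x - k)] (mod int t)"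
        by (intro cong_mult v cong_refl)
      ultimately have "[x - k = int s * (int j + 1)] (mod int t)"
        by (simp add: cong_def mult.assoc)
      then have "[x - k + k = int s * (int j + 1) + k] (mod int t)" by (rule cong_add) simp
      then show "[x = int s * (int j + 1) + k] (mod int t)" by simp
    next
      assume "[x = int s * (int j + 1) + k] (mod int t)"
      then have "[v * (x - k) = v * (int s * (int j + 1) + k - k)] (mod int t)"
        by (intro cong_mult cong_diff cong_refl)
      moreover have "[int s * v * (int j + 1) = 1 * (int j + 1)] (mod int t)"
        by (intro cong_mult v cong_refl)
      ultimately have "[v * (x - k) = int j + 1] (mod int t)"
        by (simp add: cong_def ac_simps)
      then have "[v * (x - k) - 1 = int j + 1 - 1] (mod int t)" by (rule cong_diff) simp
      then show "[v * (x - k) - 1 = int j] (mod int t)" by simp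
    qed
    finally show ?thesis .
  qed
  have self: "[x = int s * (int (cl x) + 1) + k] (mod int t)" for x using iff[OF cl_less] by blast
  have eq: "cl x = cl y \<longleftrightarrow> [x = y] (mod int t)" for x y
    using iff[OF cl_less, of x y] self[of y] by (metis cong_sym cong_trans)
  have neg: "cl (int s - 1 - x) = (if cl x = 0 then 0 else t - cl x)" for x
  proof -
    define j where "j = (if cl x = 0 then 0 else t - cl x)"
    have j: "j < t" "[int j = - int (cl x)] (mod int t)"
      using cl_less[of x] t by (auto simp: j_def cong_iff_dvd_diff of_nat_diff)
    have "[int s - 1 - x = int s - 1 - (int s * (int (cl x) + 1) + k)] (mod int t)"
      by (intro cong_diff cong_refl self)
    moreover have "[int s - 1 - (int s * (int (cl x) + 1) + k) =
        int s * (- int (cl x) + 1) + k] (mod int t)"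
    proof -
      have "int s - 1 - (int s * (int (cl x) + 1) + k) - (int s * (- int (cl x) + 1) + k)
          = - (int s + 1) - 2 * k" by (simp add: algebra_simps)
      also have "\<dots> = int t * (- (int s + 1))"
        unfolding k_def two_k_shift[OF assms(1)] by (simp add: algebra_simps)
      finally show ?thesis by (simp add: cong_iff_dvd_diff)
    qed
    moreover have "[int s * (int j + 1) + k = int s * (- int (cl x) + 1) + k] (mod int t)"
      by (intro cong_add cong_mult cong_refl j)
    ultimately have "[int s - 1 - x = int s * (int j + 1) + k] (mod int t)"
      by (meson cong_sym cong_trans)
    then have "cl (int s - 1 - x) = j" using iff[OF j(1)] by blast
    then show ?thesis by (simp add: j_def)
  qed
  show ?thesis using cl_less eq iff neg unfolding k_def by blast
qed

theorem proposition6p12: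
  fixes s t :: nat and lam :: "nat \<Rightarrow> nat"
  assumes "s \<ge> 1" and "t \<ge> 1" and "coprime s t"
    and "lam \<in> self_conjugate_cores s"
  shows
    "let t' = t div 2;
         z = (\<lambda>i::nat. nat (z_coord s t (core_of t lam) (int i)));
         u = u_coord s t (core_of t lam);
         n = card (stabilizer (H_group s t) (H_action s) lam)
     in (odd t \<longrightarrow>
           n = 2 ^ (z 0 div 2) * fact (z 0 div 2) * (\<Prod>i=1..t'. fact (z i)) \<and>
           n = 2 ^ u 0 * (\<Prod>i=0..t'. fact (u i))) \<and>
        (even t \<longrightarrow>
           n = 2 ^ (z 0 div 2) * fact (z 0 div 2) * 2 ^ (z t' div 2) * fact (z t' div 2)
                 * (\<Prod>i=1..t'-1. fact (z i)) \<and>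
           n = 2 ^ (u 0 + u t') * (\<Prod>i=0..t'. fact (u i)))"
proof -
  define S where "S = s_set s lam"
  define sg where "sg x = int s - 1 - x" for x
  define t' where "t' = t div 2"
  define z where "z i = nat (z_coord s t (core_of t lam) (int i))" for i
  define u where "u = u_coord s t (core_of t lam)"
  define n where "n = card (stabilizer (H_group s t) (H_action s) lam)"
  have core: "lam \<in> cores s" using assms(4) by (simp add: self_conjugate_cores_def)
  have finS: "finite S" using finite_s_set[OF core assms(1)] by (simp add: S_def)
  have sg_S: "sg x \<in> S" if "x \<in> S" for x
    using s_set_symmetric[OF assms(4,1)] that by (simp add: S_def sg_def)
  obtain cl :: "int \<Rightarrow> nat" where cl_less: "\<And>x. cl x < t"
    and cl_eq: "\<And>x y. cl x = cl y \<longleftrightarrow> [x = y] (mod int t)"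
    and cl_iff: "\<And>x j. j < t \<Longrightarrow> cl x = j \<longleftrightarrow> [x = int s * (int j + 1) + k_shift s t] (mod int t)"
    and cl_sg: "\<And>x. cl (sg x) = (if cl x = 0 then 0 else t - cl x)"
    using exists_class_index[OF assms(3,2)] unfolding sg_def by blast
  have z: "z j = card {x \<in> S. cl x = j}" if "j < t" for j
    using card_s_set_z_coord[OF core assms(1,2), of "int j"] that
    by (simp add: z_def S_def cl_iff flip: nat_int)
  \<comment> \<open>One point of each two-element orbit: entire classes of index strictly between 0
    and \<open>t / 2\<close>, and in self-paired classes the points strictly left of the centre
    \<open>(s - 1) / 2\<close>.\<close>
  define A where "A = {x \<in> S. 0 < cl x \<and> 2 * cl x < t \<or>
    (cl x = 0 \<or> 2 * cl x = t) \<and> 2 * x < int s - 1}"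
  have finA: "finite A" using finS by (simp add: A_def)
  let ?N = "\<lambda>j. card {x \<in> A. cl x = j}"
  have "n = card {p. p permutes S \<and> (\<forall>x\<in>S. cl (p x) = cl x \<and> p (sg x) = sg (p x))}"
    unfolding n_def card_stabilizer[OF assms(4,1)] cl_eq S_def sg_def ..
  also have "\<dots> = 2 ^ card {x \<in> A. cl (sg x) = cl x} *
      card {p. p permutes A \<and> (\<forall>x\<in>A. cl (p x) = cl x)}"
  proof (rule card_involution_permutations[OF finS])
    show "sg x \<in> A \<longleftrightarrow> x \<notin> A" if "x \<in> S" "sg x \<noteq> x" for x
    proof -
      have ne: "2 * x \<noteq> int s - 1" using that(2) by (auto simp: sg_def)
      consider "cl x = 0" | "0 < cl x" "2 * cl x < t" | "2 * cl x = t" "0 < cl x" | "t < 2 * cl x"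
        by linarith
      then show ?thesis
        using that(1) sg_S[OF that(1)] ne cl_less[of x] unfolding A_def mem_Collect_eq cl_sg
        by cases (auto simp: sg_def)
    qed
    show "sg x \<noteq> x" if "x \<in> A" for x
    proof
      assume fixed: "sg x = x"
      then have "cl x = 0 \<or> 2 * cl x = t" using cl_sg[of x] cl_less[of x] by (auto split: if_splits)
      then have "2 * x < int s - 1" using that by (auto simp: A_def)
      then show False using fixed by (simp add: sg_def)
    qed
    show "cl x = cl y" if "x \<in> A" "y \<in> A" "cl (sg x) = cl y" for x y
      using that cl_less[of x] cl_less[of y] by (auto simp: A_def cl_sg split: if_splits)
  qed (auto simp: A_def sg_S cl_sg, auto simp: sg_def)
  also have "card {p. p permutes A \<and> (\<forall>x\<in>A. cl (p x) = cl x)} = (\<Prod>j\<in>cl ` A. fact (?N j))"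
    by (rule card_class_permutations[OF finA])
  \<comment> \<open>Classes that miss \<open>A\<close> contribute \<open>fact 0\<close>, so the
    product may run over all indices up to \<open>t'\<close>.\<close>
  also have "(\<Prod>j\<in>cl ` A. fact (?N j)) = (\<Prod>j=0..t'. fact (?N j) :: nat)"
  proof (rule prod.mono_neutral_left)
    show "cl ` A \<subseteq> {0..t'}" by (auto simp: A_def t'_def)
    show "\<forall>j\<in>{0..t'} - cl ` A. fact (?N j) = (1 :: nat)"
    proof
      fix j assume "j \<in> {0..t'} - cl ` A"
      then have empty: "{x \<in> A. cl x = j} = {}" by auto
      show "fact (?N j) = (1 :: nat)" unfolding empty by simp
    qed
  qed simp
  finally have n: "n = 2 ^ card {x \<in> A. cl (sg x) = cl x} * (\<Prod>j=0..t'. fact (?N j))" .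
  have z_mid: "z j = ?N j" if "0 < j" "2 * j < t" for j
  proof -
    have "{x \<in> S. cl x = j} = {x \<in> A. cl x = j}" using that by (auto simp: A_def)
    then show ?thesis using z[of j] that by simp
  qed
  \<comment> \<open>A self-paired class consists of its chosen points, their mirror images and
    possibly the centre, so its size is twice \<open>?N j\<close> plus 0 or 1.\<close>
  have z_self: "z j div 2 = ?N j" if j: "j = 0 \<or> 2 * j = t" for j
  proof -
    let ?X = "{x \<in> A. cl x = j}" and ?F = "{x \<in> S. cl x = j \<and> 2 * x = int s - 1}"
    have "{x \<in> S. cl x = j} = (?X \<union> sg ` ?X) \<union> ?F"
    proof
      show "{x \<in> S. cl x = j} \<subseteq> (?X \<union> sg ` ?X) \<union> ?F"
      proof
        fix x assume "x \<in> {x \<in> S. cl x = j}"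
        then have x: "x \<in> S" "cl x = j" by auto
        consider "2 * x < int s - 1" | "2 * x = int s - 1" | "2 * x > int s - 1" by linarith
        then show "x \<in> (?X \<union> sg ` ?X) \<union> ?F"
        proof cases
          case 3
          have "cl (sg x) = j" using j x cl_sg[of x] by auto
          then have "sg x \<in> ?X" using 3 j sg_S[OF x(1)] by (auto simp: A_def sg_def)
          moreover have "x = sg (sg x)" by (simp add: sg_def)
          ultimately show ?thesis by blast
        qed (use x j in \<open>auto simp: A_def\<close>)
      qed
      have "cl (sg x) = j" if "cl x = j" for x using j that cl_sg[of x] by auto
      then show "(?X \<union> sg ` ?X) \<union> ?F \<subseteq> {x \<in> S. cl x = j}"
        using sg_S by (auto simp: A_def)
    qed
    moreover have "card ((?X \<union> sg ` ?X) \<union> ?F) = card ?X + card ?X + card ?F"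
    proof -
      have card_sg: "card (sg ` ?X) = card ?X"
        by (intro card_image inj_onI) (simp add: sg_def)
      have less: "2 * x < int s - 1" if "x \<in> ?X" for x
        using that j unfolding A_def mem_Collect_eq by (elim conjE disjE) linarith+
      have "sg x \<notin> ?X" if "x \<in> ?X" for x
      proof
        assume "sg x \<in> ?X"
        from less[OF this] less[OF that] show False by (simp add: sg_def)
      qed
      then have disj: "?X \<inter> sg ` ?X = {}" by blast
      have "2 * x \<noteq> int s - 1" "2 * sg x \<noteq> int s - 1" if "x \<in> ?X" for x
        using less[OF that] by (simp_all add: sg_def)
      then have "(?X \<union> sg ` ?X) \<inter> ?F = {}" by blast
      then show ?thesis using finA finS disj card_sg by (simp add: card_Un_disjoint)
    qed
    moreover have "card ?F \<le> 1"
    proof -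
      have "?F \<subseteq> {(int s - 1) div 2}" by auto
      then show ?thesis using card_mono[of "{(int s - 1) div 2}" ?F] by simp
    qed
    moreover have "j < t" using j assms(2) by auto
    ultimately show ?thesis using z[of j] by auto
  qed
  have u: "u j = ?N j" if "j \<le> t'" for j
  proof -
    consider "j = 0" | "0 < j" "2 * j = t" | "0 < j" "2 * j < t"
      using \<open>j \<le> t'\<close> unfolding t'_def by linarith
    then show ?thesis
    proof cases
      case 1
      then show ?thesis using z_self[of 0] by (simp add: u_def u_coord_def z_def nat_div_distrib')
    next
      case 2
      then show ?thesis
        using z_self[of j] by (auto simp: u_def u_coord_def z_def nat_div_distrib')
    next
      case 3
      then show ?thesis using z_mid[of j] by (auto simp: u_def u_coord_def z_def)
    qed
  qed
  have u_prod: "(\<Prod>j=0..t'. fact (?N j)) = (\<Prod>j=0..t'. fact (u j) :: nat)"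
    by (rule prod.cong) (simp_all add: u)
  have z0: "u 0 = z 0 div 2" using u[of 0] z_self[of 0] by simp
  have split: "(\<Prod>j=0..t'. fact (u j)) = fact (u 0) * (\<Prod>j=1..t'. fact (u j) :: nat)"
    by (simp add: prod.atLeast_Suc_atMost)
  have odd: "n = 2 ^ (z 0 div 2) * fact (z 0 div 2) * (\<Prod>i=1..t'. fact (z i)) \<and>
      n = 2 ^ u 0 * (\<Prod>i=0..t'. fact (u i))" if "odd t"
  proof -
    \<comment> \<open>For odd \<open>t\<close> this leaves the class 0 as the only self-paired
      one.\<close>
    have "t - cl x \<noteq> cl x" for x
    proof
      assume "t - cl x = cl x"
      then have "t = 2 * cl x" using cl_less[of x] by linarith
      then show False using \<open>odd t\<close> by simp
    qed
    then have "{x \<in> A. cl (sg x) = cl x} = {x \<in> A. cl x = 0}"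
      by (auto simp: cl_sg split: if_splits)
    then have n': "n = 2 ^ u 0 * (\<Prod>j=0..t'. fact (u j))" using n u[of 0] u_prod by simp
    have "(\<Prod>j=1..t'. fact (u j)) = (\<Prod>j=1..t'. fact (z j) :: nat)"
    proof (rule prod.cong)
      fix j assume "j \<in> {1..t'}"
      then have "0 < j" "j \<le> t'" "2 * j < t" using \<open>odd t\<close> unfolding t'_def by auto presburger
      then show "fact (u j) = (fact (z j) :: nat)" using u z_mid by simp
    qed simp
    then show ?thesis using n' split z0 by simp
  qed
  have even: "n = 2 ^ (z 0 div 2) * fact (z 0 div 2) * 2 ^ (z t' div 2) * fact (z t' div 2)
        * (\<Prod>i=1..t'-1. fact (z i)) \<and>
      n = 2 ^ (u 0 + u t') * (\<Prod>i=0..t'. fact (u i))" if "even t"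
  proof -
    have t: "2 * t' = t" "1 \<le> t'" using \<open>even t\<close> assms(2) by (auto simp: t'_def)
    have zt: "u t' = z t' div 2" using u[of t'] z_self[of t'] t by simp
    have "{x \<in> A. cl (sg x) = cl x} = {x \<in> A. cl x = 0} \<union> {x \<in> A. cl x = t'}"
      using t cl_less by (auto simp: cl_sg split: if_splits)
    moreover have "{x \<in> A. cl x = 0} \<inter> {x \<in> A. cl x = t'} = {}" using t by auto
    ultimately have "card {x \<in> A. cl (sg x) = cl x} = u 0 + u t'"
      using finA u[of 0] u[of t'] by (simp add: card_Un_disjoint)
    then have n': "n = 2 ^ (u 0 + u t') * (\<Prod>j=0..t'. fact (u j))" using n u_prod by simp
    \<comment> \<open>The index \<open>t'\<close> is split off since its class is self-paired: there
      \<open>u\<close> is half of \<open>z\<close> rounded down, whereas \<open>u\<close> and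
      \<open>z\<close> agree at the smaller positive indices.\<close>
    have "{1..t'} = insert t' {1..t' - 1}" using t(2) by auto
    then have "(\<Prod>j=1..t'. fact (u j)) = fact (u t') * (\<Prod>j=1..t'-1. fact (u j) :: nat)"
      using t(2) by simp
    also have "(\<Prod>j=1..t'-1. fact (u j)) = (\<Prod>j=1..t'-1. fact (z j) :: nat)"
    proof (rule prod.cong)
      fix j assume "j \<in> {1..t' - 1}"
      then have "0 < j" "j \<le> t'" "2 * j < t" using t by auto
      then show "fact (u j) = (fact (z j) :: nat)" using u z_mid by simp
    qed simp
    finally show ?thesis using n' split z0 zt by (simp add: power_add)
  qed
  show ?thesis using odd even unfolding Let_def n_def u_def z_def t'_def by blast
qed

end
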